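(* Suppose $\mu=0$. Then, as $n\to\infty$, \[ n^{-1/2}\operatorname{hull}\{S_0,S_1,\ldots,S_n\} \Rightarrow \Sigma^{1/2} h_1 \] in the sense of weak convergence on $(\mathcal{K}_2^0,\rho_H)$.
   Context: $Z$ is a random vector in $\mathbb{R}^2$ with $\mathbb{E}[\|Z\|^2]<\infty$; $Z_1,Z_2,\ldots$ are i.i.d. copies of $Z$; $S_0=0$, $S_n=\sum_{k=1}^n Z_k$. $\mu=\mathbb{E}Z$ and $\Sigma=\mathbb{E}[(Z-\mu)(Z-\mu)^\top]$; $\Sigma^{1/2}$ is its positive semidefinite symmetric square root. $b=(b(s))_{s\in[0,1]}$ is standard Brownian motion in $\mathbb{R}^2$ with $b(0)=0$, and $h_1=\operatorname{hull} b[0,1]$ is the convex hull of its path. $\mathcal{K}_2^0$ is the collection of compact convex subsets of $\mathbb{R}^2$ containing the origin, with the Hausdorff metric $\rho_H(A,B)=\max\{\sup_{x\in B}\rho(x,A),\sup_{y\in A}\rho(y,B)\}$, $\rho(x,A)=\inf_{y\in A}\|x-y\|$. *)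

theory Defs
  imports "HOL-Probability.Probability"
begin

definition hausdorff_dist :: "'a::metric_space set \<Rightarrow> 'a set \<Rightarrow> real" where
  "hausdorff_dist A B = max (SUP x\<in>B. infdist x A) (SUP y\<in>A. infdist y B)"

definition K20 :: "(real^2) set set" where
  "K20 = {K. compact K \<and> convex K \<and> (0::real^2) \<in> K}"

definition bcont_K20 :: "((real^2) set \<Rightarrow> real) \<Rightarrow> bool" where
  "bcont_K20 f \<longleftrightarrow> bounded (f ` K20) \<and>
     (\<forall>K\<in>K20. \<forall>e>0. \<exists>d>0. \<forall>L\<in>K20. hausdorff_dist L K < d \<longrightarrow> \<bar>f L - f K\<bar> < e)"

definition weak_conv_K20 ::
    "'a measure \<Rightarrow> (nat \<Rightarrow> 'a \<Rightarrow> (real^2) set) \<Rightarrow> 'b measure \<Rightarrow> ('b \<Rightarrow> (real^2) set) \<Rightarrow> bool" where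
  "weak_conv_K20 M X N Y \<longleftrightarrow>
     (\<forall>f. bcont_K20 f \<longrightarrow>
        (\<lambda>n. \<integral>\<omega>. f (X n \<omega>) \<partial>M) \<longlonglongrightarrow> (\<integral>\<omega>. f (Y \<omega>) \<partial>N))"

definition std_BM2 :: "'b measure \<Rightarrow> ('b \<Rightarrow> real \<Rightarrow> real^2) \<Rightarrow> bool" where
  "std_BM2 N b \<longleftrightarrow> prob_space N \<and>
     (\<forall>\<omega>\<in>space N. b \<omega> 0 = 0 \<and> continuous_on {0..1} (b \<omega>)) \<and>
     (\<forall>s t. 0 \<le> s \<and> s < t \<and> t \<le> 1 \<longrightarrow>
        distributed N lborel (\<lambda>\<omega>. b \<omega> t - b \<omega> s)
          (\<lambda>x. ennreal (normal_density 0 (sqrt (t - s)) (x $ 1) *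
                         normal_density 0 (sqrt (t - s)) (x $ 2)))) \<and>
     (\<forall>ts::real list. sorted_wrt (<) ts \<and> set ts \<subseteq> {0..1} \<longrightarrow>
        prob_space.indep_vars N (\<lambda>_. borel)
          (\<lambda>i \<omega>. b \<omega> (ts ! Suc i) - b \<omega> (ts ! i)) {..<length ts - 1})"

definition mean_vec :: "'a measure \<Rightarrow> ('a \<Rightarrow> real^2) \<Rightarrow> real^2" where
  "mean_vec M X = (\<integral>\<omega>. X \<omega> \<partial>M)"

definition cov_matrix :: "'a measure \<Rightarrow> ('a \<Rightarrow> real^2) \<Rightarrow> real^2^2" where
  "cov_matrix M X = (\<chi> i j. \<integral>\<omega>. (X \<omega> $ i - mean_vec M X $ i) * (X \<omega> $ j - mean_vec M X $ j) \<partial>M)"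

definition psd_sqrt :: "real^2^2 \<Rightarrow> real^2^2" where
  "psd_sqrt S = (THE A. transpose A = A \<and> (\<forall>x. 0 \<le> x \<bullet> (A *v x)) \<and> A ** A = S)"

end

theory Submission
  imports Defs
begin

text \<open>It suffices to test weak convergence on bounded Lipschitz functions of compact convex sets: a bounded
  continuous function is the increasing pointwise limit of its Lipschitz minorants
  \<open>inf\<^sub>L (f L + k * d K L)\<close>. For a Lipschitz test function, the hull of the walk is replaced by
  the hull of its values at \<open>m\<close> equally spaced times; by Ottaviani's inequality and the fourth moment
  of the Gaussian limit, the cost of this replacement vanishes as \<open>m\<close> grows, after \<open>n\<close> has tended to infinity.
  The coarse hull is a Lipschitz function of \<open>m\<close> i.i.d. block sums. Their laws converge by the one-dimensional
  central limit theorem for each projection: convergence of characteristic functions gives pointwise convergence of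
  the densities after Gaussian smoothing, hence convergence of integrals uniformly over bounded Lipschitz functions,
  which allows the blocks to be replaced by Brownian increments one at a time.\<close>

section \<open>The Hausdorff metric and Lipschitz test functions\<close>

text \<open>The steps have only second moments, and this dictates the order of the limits. With
  \<open>m\<close> blocks, the oscillation is bounded by a multiple of \<open>m + 1\<close> times
  the tail of one block sum. Chebyshev's inequality bounds that tail only by a multiple of
  \<open>1 / m\<close>, so the product need not vanish. When \<open>n\<close> tends to infinity with
  \<open>m\<close> fixed, the block sum becomes Gaussian with standard deviation of order
  \<open>1 / sqrt m\<close>; fourth moments then give a tail of order \<open>1 / m^2\<close>, which
  wins. The covariance may be singular, so the limit law need not have a density: densities are
  compared only after convolution with a nondegenerate Gaussian. Finally, a non-integrable function
  has integral 0 by convention, so measurability has to be established for each test function. A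
  Lipschitz function of the hull of finitely many partial sums is continuous in finitely many steps;
  pathwise limits carry measurability to the Brownian hull, and the minorants carry it to all
  bounded continuous test functions.\<close>

lemma bdd_above_infdist_image:
  assumes "bounded B"
  shows "bdd_above ((\<lambda>x. infdist x A) ` B)"
proof (cases "B = {}")
  case False
  then obtain y where "y \<in> B" by blast
  obtain e where e: "\<And>x. x \<in> B \<Longrightarrow> dist y x \<le> e"
    using assms by (meson bounded_any_center)
  show ?thesis
  proof (rule bdd_aboveI2)
    fix x assume "x \<in> B"
    show "infdist x A \<le> infdist y A + e"
      using infdist_triangle[of x A y] e[OF \<open>x \<in> B\<close>] by (simp add: dist_commute)
  qed
qed simp

lemma hausdorff_dist_commute: "hausdorff_dist A B = hausdorff_dist B A"
  by (simp add: hausdorff_dist_def max.commute)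

lemma infdist_le_hausdorff_dist:
  assumes "bounded B" "x \<in> B"
  shows "infdist x A \<le> hausdorff_dist A B"
  unfolding hausdorff_dist_def
  by (rule max.coboundedI1, rule cSUP_upper[OF assms(2) bdd_above_infdist_image[OF assms(1)]])

lemma hausdorff_dist_le:
  assumes "A \<noteq> {}" "B \<noteq> {}" "\<And>x. x \<in> B \<Longrightarrow> infdist x A \<le> d" "\<And>x. x \<in> A \<Longrightarrow> infdist x B \<le> d"
  shows "hausdorff_dist A B \<le> d"
  unfolding hausdorff_dist_def using assms by (auto intro!: cSUP_least)

lemma hausdorff_dist_nonneg:
  assumes "bounded B" "B \<noteq> {}"
  shows "0 \<le> hausdorff_dist A B"
  using assms infdist_le_hausdorff_dist[OF assms(1)] by (meson all_not_in_conv infdist_nonneg order_trans)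

lemma infdist_triangle_hausdorff:
  assumes "bounded B" "B \<noteq> {}"
  shows "infdist x A \<le> infdist x B + hausdorff_dist A B"
proof -
  have "infdist x A - hausdorff_dist A B \<le> (INF b\<in>B. dist x b)"
  proof (rule cINF_greatest[OF assms(2)])
    fix b assume "b \<in> B"
    then show "infdist x A - hausdorff_dist A B \<le> dist x b"
      using infdist_triangle[of x A b] infdist_le_hausdorff_dist[OF assms(1), of b A] by simp
  qed
  then show ?thesis by (simp add: infdist_notempty assms(2))
qed

lemma hausdorff_dist_triangle:
  assumes "bounded A" "A \<noteq> {}" "bounded B" "B \<noteq> {}" "bounded C" "C \<noteq> {}"
  shows "hausdorff_dist A C \<le> hausdorff_dist A B + hausdorff_dist B C"
proof (rule hausdorff_dist_le[OF assms(2,6)])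
  fix x assume "x \<in> C"
  then show "infdist x A \<le> hausdorff_dist A B + hausdorff_dist B C"
    using infdist_triangle_hausdorff[OF assms(3,4), of x A]
      infdist_le_hausdorff_dist[OF assms(5), of x B] by simp
next
  fix x assume "x \<in> A"
  then show "infdist x C \<le> hausdorff_dist A B + hausdorff_dist B C"
    using infdist_triangle_hausdorff[OF assms(3,4), of x C]
      infdist_le_hausdorff_dist[OF assms(1), of x B] by (simp add: hausdorff_dist_commute)
qed

text \<open>The Minkowski sum of \<open>convex hull Q\<close> and the closed ball of radius
  \<open>d\<close> is convex and contains \<open>P\<close>, hence contains
  \<open>convex hull P\<close>. In this way estimates on vertices become estimates on hulls.\<close>

lemma infdist_convex_hull_le:
  fixes P Q :: "'a::real_normed_vector set"
  assumes PQ: "\<And>p. p \<in> P \<Longrightarrow> \<exists>q\<in>Q. dist p q \<le> d" and x: "x \<in> convex hull P"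
  shows "infdist x (convex hull Q) \<le> d"
proof -
  let ?S = "\<Union>a\<in>convex hull Q. \<Union>b\<in>cball 0 d. {a + b}"
  have "convex hull P \<subseteq> ?S"
  proof (rule hull_minimal)
    show "P \<subseteq> ?S"
    proof
      fix p assume "p \<in> P"
      then obtain q where q: "q \<in> Q" "dist p q \<le> d" using PQ by blast
      then have "q \<in> convex hull Q" "p - q \<in> cball 0 d" "p = q + (p - q)"
        by (auto simp: hull_inc dist_norm norm_minus_commute)
      then show "p \<in> ?S" by blast
    qed
    show "convex ?S"
      by (intro convex_sums) auto
  qed
  then obtain a b where "a \<in> convex hull Q" "norm b \<le> d" "x = a + b"
    using x by auto
  then show ?thesis
    by (auto intro!: infdist_le2[of a] simp: dist_norm)
qed

lemma hausdorff_dist_convex_hull_le: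
  fixes P Q :: "'a::real_normed_vector set"
  assumes "P \<noteq> {}" "Q \<noteq> {}"
    and "\<And>p. p \<in> P \<Longrightarrow> \<exists>q\<in>Q. dist p q \<le> d" "\<And>q. q \<in> Q \<Longrightarrow> \<exists>p\<in>P. dist q p \<le> d"
  shows "hausdorff_dist (convex hull P) (convex hull Q) \<le> d"
  using assms by (intro hausdorff_dist_le infdist_convex_hull_le) auto

lemma K20D:
  assumes "K \<in> K20" shows "bounded K" "K \<noteq> {}"
  using assms by (auto simp: K20_def compact_imp_bounded)

lemma convex_hull_in_K20: "compact P \<Longrightarrow> 0 \<in> P \<Longrightarrow> convex hull P \<in> K20"
  by (auto simp: K20_def compact_convex_hull hull_inc)

section \<open>Reduction of weak convergence to Lipschitz test functions\<close>

definition lip_K20 :: "real \<Rightarrow> real \<Rightarrow> ((real^2) set \<Rightarrow> real) \<Rightarrow> bool" where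
  "lip_K20 B C f \<longleftrightarrow> (\<forall>K\<in>K20. \<bar>f K\<bar> \<le> B) \<and>
     (\<forall>K\<in>K20. \<forall>L\<in>K20. \<bar>f K - f L\<bar> \<le> C * hausdorff_dist K L)"

text \<open>The Pasch-Hausdorff envelope: infimal convolution of \<open>f\<close> with
  \<open>k\<close> times the metric.\<close>

definition lip_minorant :: "((real^2) set \<Rightarrow> real) \<Rightarrow> nat \<Rightarrow> (real^2) set \<Rightarrow> real" where
  "lip_minorant f k K = (INF L\<in>K20. f L + real k * hausdorff_dist K L)"

lemma K20_nonempty: "K20 \<noteq> {}"
  using convex_hull_in_K20[of "{0}"] by auto

lemma hausdorff_dist_self:
  assumes "A \<noteq> {}" "bounded A" shows "hausdorff_dist A A = 0"
proof (rule antisym)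
  show "hausdorff_dist A A \<le> 0" by (rule hausdorff_dist_le) (use assms in auto)
qed (use assms hausdorff_dist_nonneg in auto)

lemma lip_minorant_bounds:
  assumes B: "\<And>K. K \<in> K20 \<Longrightarrow> \<bar>f K\<bar> \<le> B" and K: "K \<in> K20"
  shows "bdd_below ((\<lambda>L. f L + real k * hausdorff_dist K L) ` K20)"
    "lip_minorant f k K \<le> f K" "- B \<le> lip_minorant f k K"
proof -
  have *: "- B \<le> f L + real k * hausdorff_dist K L" if "L \<in> K20" for L
    using B[OF that] hausdorff_dist_nonneg[OF K20D[OF that], of K]
    by (smt (verit) mult_nonneg_nonneg of_nat_0_le_iff)
  then show bdd: "bdd_below ((\<lambda>L. f L + real k * hausdorff_dist K L) ` K20)"
    by (meson bdd_belowI2)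
  show "lip_minorant f k K \<le> f K"
    using cINF_lower[OF bdd K] hausdorff_dist_self[OF K20D(2,1)[OF K]] by (simp add: lip_minorant_def)
  show "- B \<le> lip_minorant f k K"
    unfolding lip_minorant_def using * K20_nonempty by (intro cINF_greatest)
qed

text \<open>By the triangle inequality every function under the infimum is
  \<open>k\<close>-Lipschitz in \<open>K\<close>, and an infimum keeps a common Lipschitz
  constant.\<close>

lemma lip_minorant_lip:
  assumes B: "\<And>K. K \<in> K20 \<Longrightarrow> \<bar>f K\<bar> \<le> B"
  shows "lip_K20 B (real k) (lip_minorant f k)"
proof -
  have *: "lip_minorant f k K - real k * hausdorff_dist K K' \<le> lip_minorant f k K'"
    if K: "K \<in> K20" "K' \<in> K20" for K K'
    unfolding lip_minorant_def[of f k K']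
  proof (rule cINF_greatest[OF K20_nonempty])
    fix L assume L: "L \<in> K20"
    have "lip_minorant f k K \<le> f L + real k * hausdorff_dist K L"
      unfolding lip_minorant_def by (rule cINF_lower[OF lip_minorant_bounds(1)[OF B K(1)] L])
    also have "\<dots> \<le> f L + real k * (hausdorff_dist K K' + hausdorff_dist K' L)"
      by (intro add_left_mono mult_left_mono hausdorff_dist_triangle K20D K L) simp
    finally show "lip_minorant f k K - real k * hausdorff_dist K K'
        \<le> f L + real k * hausdorff_dist K' L"
      by (simp add: algebra_simps)
  qed
  show ?thesis
    unfolding lip_K20_def
  proof (intro conjI ballI)
    fix K assume K: "K \<in> K20"
    show "\<bar>lip_minorant f k K\<bar> \<le> B"
      using lip_minorant_bounds(2)[of f, OF B K, where k = k] lip_minorant_bounds(3)[of f, OF B K, where k = k] B[OF K] by linarith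
  next
    fix K L assume "K \<in> K20" "L \<in> K20"
    then show "\<bar>lip_minorant f k K - lip_minorant f k L\<bar> \<le> real k * hausdorff_dist K L"
      using *[of K L] *[of L K] by (simp add: hausdorff_dist_commute abs_le_iff)
  qed
qed

lemma bcont_K20_bounded: "bcont_K20 f \<Longrightarrow> \<exists>B. \<forall>K\<in>K20. \<bar>f K\<bar> \<le> B"
  by (simp add: bcont_K20_def bounded_iff)

lemma lip_minorant_tendsto:
  assumes f: "bcont_K20 f" and K: "K \<in> K20"
  shows "(\<lambda>k. lip_minorant f k K) \<longlonglongrightarrow> f K"
proof -
  obtain B where B: "\<And>K. K \<in> K20 \<Longrightarrow> \<bar>f K\<bar> \<le> B"
    using bcont_K20_bounded[OF f] by blast
  show ?thesis
  proof (rule LIMSEQ_I)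
    fix e :: real assume "0 < e"
    then obtain d where d: "d > 0" "\<And>L. L \<in> K20 \<Longrightarrow> hausdorff_dist L K < d \<Longrightarrow> \<bar>f L - f K\<bar> < e / 2"
      using f K unfolding bcont_K20_def by (meson half_gt_zero)
    \<comment> \<open>As soon as \<open>k * d\<close> reaches \<open>2 * B\<close>, a bound for the
      oscillation of \<open>f\<close>, sets at distance at least \<open>d\<close> cannot push the
      infimum below \<open>f K\<close>. Closer sets are handled by continuity at
      \<open>K\<close>.\<close>
    obtain k0 where k0: "2 * B / d \<le> real k0" using real_arch_simple by blast
    show "\<exists>k0. \<forall>k\<ge>k0. norm (lip_minorant f k K - f K) < e"
    proof (intro exI allI impI)
      fix k assume "k0 \<le> k"
      then have "2 * B / d \<le> real k" using k0 by linarith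
      then have k: "2 * B \<le> real k * d" using d by (simp add: field_simps)
      have "f K - e / 2 \<le> lip_minorant f k K"
        unfolding lip_minorant_def
      proof (rule cINF_greatest[OF K20_nonempty])
        fix L assume L: "L \<in> K20"
        show "f K - e / 2 \<le> f L + real k * hausdorff_dist K L"
        proof (cases "hausdorff_dist L K < d")
          case True
          have "0 \<le> real k * hausdorff_dist K L" using hausdorff_dist_nonneg[OF K20D[OF L]] by simp
          then show ?thesis using d(2)[OF L True] by (smt (verit) field_sum_of_halves)
        next
          case False
          then have "real k * d \<le> real k * hausdorff_dist K L"
            by (intro mult_left_mono) (auto simp: hausdorff_dist_commute)
          then show ?thesis using k B[OF K] B[OF L] \<open>0 < e\<close> by linarith
        qed
      qed
      then show "norm (lip_minorant f k K - f K) < e"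
        using lip_minorant_bounds(2)[of f, OF B K, where k = k] \<open>0 < e\<close> by simp
    qed
  qed
qed

lemma bcont_K20_uminus: "bcont_K20 f \<Longrightarrow> bcont_K20 (\<lambda>K. - f K)"
  unfolding bcont_K20_def
proof (elim conjE, intro conjI)
  assume "bounded (f ` K20)"
  then show "bounded ((\<lambda>K. - f K) ` K20)" by (auto simp: bounded_iff)
qed (simp add: abs_minus_commute)

text \<open>Assumptions about Lipschitz functions suffice: \<open>f\<close> is a pointwise limit of
  its minorants, so it inherits measurability, and one minorant with nearly the same integral along
  \<open>Y\<close> bounds the integrals along \<open>X n\<close> from below.\<close>

lemma weak_conv_K20_if_lip:
  assumes "prob_space M" "prob_space N"
    and X: "\<And>n \<omega>. \<omega> \<in> space M \<Longrightarrow> X n \<omega> \<in> K20" and Y: "\<And>\<omega>. \<omega> \<in> space N \<Longrightarrow> Y \<omega> \<in> K20"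
    and mX: "\<And>B C f n. lip_K20 B C f \<Longrightarrow> (\<lambda>\<omega>. f (X n \<omega>)) \<in> borel_measurable M"
    and mY: "\<And>B C f. lip_K20 B C f \<Longrightarrow> (\<lambda>\<omega>. f (Y \<omega>)) \<in> borel_measurable N"
    and lim: "\<And>B C f. lip_K20 B C f \<Longrightarrow> (\<lambda>n. \<integral>\<omega>. f (X n \<omega>) \<partial>M) \<longlonglongrightarrow> (\<integral>\<omega>. f (Y \<omega>) \<partial>N)"
  shows "weak_conv_K20 M X N Y"
proof -
  interpret M: prob_space M by fact
  interpret N: prob_space N by fact
  have key: "\<forall>\<^sub>F n in sequentially. (\<integral>\<omega>. f (Y \<omega>) \<partial>N) - e < (\<integral>\<omega>. f (X n \<omega>) \<partial>M)"
    if f: "bcont_K20 f" and "e > 0" for f e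
  proof -
    obtain B where B: "\<And>K. K \<in> K20 \<Longrightarrow> \<bar>f K\<bar> \<le> B"
      using bcont_K20_bounded[OF f] by blast
    let ?f = "lip_minorant f"
    have lip: "lip_K20 B (real k) (?f k)" for k by (rule lip_minorant_lip[OF B])
    have fB: "\<bar>?f k K\<bar> \<le> B" if "K \<in> K20" for k K
      using lip[of k] that by (auto simp: lip_K20_def)
    have mfX: "(\<lambda>\<omega>. f (X n \<omega>)) \<in> borel_measurable M" for n
      by (rule borel_measurable_LIMSEQ_real[OF lip_minorant_tendsto[OF f X] mX[OF lip]])
    have mfY: "(\<lambda>\<omega>. f (Y \<omega>)) \<in> borel_measurable N"
      by (rule borel_measurable_LIMSEQ_real[OF lip_minorant_tendsto[OF f Y] mY[OF lip]])
    have "(\<lambda>k. \<integral>\<omega>. ?f k (Y \<omega>) \<partial>N) \<longlonglongrightarrow> (\<integral>\<omega>. f (Y \<omega>) \<partial>N)"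
      by (rule integral_dominated_convergence[where w = "\<lambda>_. B"])
        (auto simp: mfY mY[OF lip] lip_minorant_tendsto[OF f Y] fB[OF Y])
    then have "\<forall>\<^sub>F k in sequentially. (\<integral>\<omega>. f (Y \<omega>) \<partial>N) - e < (\<integral>\<omega>. ?f k (Y \<omega>) \<partial>N)"
      by (rule order_tendstoD) (use \<open>e > 0\<close> in simp)
    then obtain k where k: "(\<integral>\<omega>. f (Y \<omega>) \<partial>N) - e < (\<integral>\<omega>. ?f k (Y \<omega>) \<partial>N)"
      by (auto simp: eventually_sequentially)
    have "\<forall>\<^sub>F n in sequentially. (\<integral>\<omega>. f (Y \<omega>) \<partial>N) - e < (\<integral>\<omega>. ?f k (X n \<omega>) \<partial>M)"
      by (rule order_tendstoD(1)[OF lim[OF lip] k])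
    then show ?thesis
    proof (rule eventually_mono)
      fix n assume "(\<integral>\<omega>. f (Y \<omega>) \<partial>N) - e < (\<integral>\<omega>. ?f k (X n \<omega>) \<partial>M)"
      also have "(\<integral>\<omega>. ?f k (X n \<omega>) \<partial>M) \<le> (\<integral>\<omega>. f (X n \<omega>) \<partial>M)"
      proof (rule integral_mono)
        show "integrable M (\<lambda>\<omega>. ?f k (X n \<omega>))"
          by (rule M.integrable_const_bound[where B = B]) (auto simp: mX[OF lip] fB[OF X])
        show "integrable M (\<lambda>\<omega>. f (X n \<omega>))"
          by (rule M.integrable_const_bound[where B = B]) (auto simp: mfX B[OF X])
        show "?f k (X n \<omega>) \<le> f (X n \<omega>)" if "\<omega> \<in> space M" for \<omega>
          by (rule lip_minorant_bounds(2)[OF B X[OF that]])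
      qed
      finally show "(\<integral>\<omega>. f (Y \<omega>) \<partial>N) - e < (\<integral>\<omega>. f (X n \<omega>) \<partial>M)" .
    qed
  qed
  show ?thesis
    unfolding weak_conv_K20_def
  proof (intro allI impI tendstoI)
    fix f and e :: real assume f: "bcont_K20 f" and e: "0 < e"
    \<comment> \<open>The one-sided bound for \<open>- f\<close> is the missing upper bound for
      \<open>f\<close>.\<close>
    from key[OF f e] key[OF bcont_K20_uminus[OF f] e]
    show "\<forall>\<^sub>F n in sequentially. dist (\<integral>\<omega>. f (X n \<omega>) \<partial>M) (\<integral>\<omega>. f (Y \<omega>) \<partial>N) < e"
      by eventually_elim (auto simp: dist_real_def)
  qed
qed

section \<open>Planar Gaussian laws\<close>

definition vec2 :: "real \<Rightarrow> real \<Rightarrow> real^2" where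
  "vec2 x y = x *\<^sub>R axis 1 1 + y *\<^sub>R axis 2 1"

lemma vec2_nth [simp]: "vec2 x y $ 1 = x" "vec2 x y $ 2 = y"
  by (simp_all add: vec2_def axis_def)

lemma measurable_vec2 [measurable]: "case_prod vec2 \<in> borel_measurable (borel \<Otimes>\<^sub>M borel)"
  unfolding vec2_def by measurable

lemma measurable_vec_nth' [measurable]: "(\<lambda>x::real^'n. x $ i) \<in> borel_measurable borel"
  by (intro borel_measurable_continuous_onI continuous_intros)

lemma inner_vec2: "(x::real^2) \<bullet> y = x $ 1 * y $ 1 + x $ 2 * y $ 2"
  by (simp add: inner_vec_def sum_2)

lemma norm_vec2_sq: "(norm (x::real^2))\<^sup>2 = (x $ 1)\<^sup>2 + (x $ 2)\<^sup>2"
  unfolding power2_norm_eq_inner inner_vec2 by (simp add: power2_eq_square)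

lemma norm_vec2_le: "norm (x::real^2) \<le> \<bar>x $ 1\<bar> + \<bar>x $ 2\<bar>"
  using norm_le_l1_cart[of x] by (simp add: sum_2)

lemma prod_Basis_vec2: "(\<Prod>b\<in>(Basis::(real^2) set). f b) = f (axis 1 1) * f (axis 2 1)"
proof -
  have B: "(Basis::(real^2) set) = {axis 1 1, axis 2 1}"
    by (auto simp: Basis_vec_def UNIV_2)
  have "axis 1 1 \<noteq> (axis 2 1 :: real^2)" by (simp add: axis_eq_axis)
  then show ?thesis unfolding B by simp
qed

text \<open>Boxes determine Lebesgue measure, and \<open>vec2\<close> pulls a box back to a product
  of two intervals.\<close>

lemma lborel_vec2: "(lborel :: (real^2) measure) = distr (lborel \<Otimes>\<^sub>M lborel) borel (case_prod vec2)"
proof (rule lborel_eqI)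
  fix l u :: "real^2" assume "\<And>b. b \<in> Basis \<Longrightarrow> l \<bullet> b \<le> u \<bullet> b"
  then have le: "l $ i \<le> u $ i" for i by (metis axis_in_Basis_iff cart_eq_inner_axis Basis_real_def insertI1)
  have "emeasure (distr (lborel \<Otimes>\<^sub>M lborel) borel (case_prod vec2)) (box l u)
      = emeasure (lborel \<Otimes>\<^sub>M lborel) (box (l $ 1) (u $ 1) \<times> box (l $ 2) (u $ 2))"
    by (subst emeasure_distr)
      (auto simp: space_pair_measure mem_box_cart forall_2 box_real intro!: arg_cong2[where f = emeasure])
  also have "\<dots> = ennreal (u $ 1 - l $ 1) * ennreal (u $ 2 - l $ 2)"
    by (subst lborel.emeasure_pair_measure_Times) (use le in auto)
  also have "\<dots> = (\<Prod>b\<in>Basis. (u - l) \<bullet> b)"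
    using le by (subst prod_Basis_vec2) (simp add: ennreal_mult cart_eq_inner_axis[symmetric])
  finally show "emeasure (distr (lborel \<Otimes>\<^sub>M lborel) borel (case_prod vec2)) (box l u)
      = ennreal (\<Prod>b\<in>Basis. (u - l) \<bullet> b)" .
qed simp

definition gauss1 :: "real \<Rightarrow> real measure" where
  "gauss1 s = density lborel (normal_density 0 s)"

definition dens2 :: "real \<Rightarrow> real^2 \<Rightarrow> real" where
  "dens2 s x = normal_density 0 s (x $ 1) * normal_density 0 s (x $ 2)"

text \<open>For \<open>s > 0\<close>, the law of a planar Brownian increment over a time span
  \<open>s^2\<close>; \<open>s\<close> is the standard deviation of each coordinate.\<close>

definition gauss2 :: "real \<Rightarrow> (real^2) measure" where
  "gauss2 s = density lborel (dens2 s)"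

lemma dens2_nonneg [simp]: "0 \<le> dens2 s x"
  by (simp add: dens2_def)

lemma measurable_dens2 [measurable]: "dens2 s \<in> borel_measurable borel"
  unfolding dens2_def by measurable

lemma sets_gauss1 [simp, measurable_cong]: "sets (gauss1 s) = sets borel"
  by (simp add: gauss1_def)

lemma sets_gauss2 [simp, measurable_cong]: "sets (gauss2 s) = sets borel"
  by (simp add: gauss2_def)

lemma space_gauss2 [simp]: "space (gauss2 s) = UNIV"
  by (simp add: gauss2_def)

lemma prob_space_gauss1: "0 < s \<Longrightarrow> prob_space (gauss1 s)"
  unfolding gauss1_def by (rule prob_space_normal_density)

lemma gauss2_eq_distr:
  assumes "0 < s"
  shows "gauss2 s = distr (gauss1 s \<Otimes>\<^sub>M gauss1 s) borel (case_prod vec2)"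
proof -
  interpret prob_space "gauss1 s" by (rule prob_space_gauss1[OF assms])
  have "gauss1 s \<Otimes>\<^sub>M gauss1 s = density (lborel \<Otimes>\<^sub>M lborel)
      (\<lambda>(x, y). ennreal (normal_density 0 s x) * ennreal (normal_density 0 s y))"
    unfolding gauss1_def
    by (rule pair_measure_density)
      (use sigma_finite_measure_axioms in \<open>auto simp: gauss1_def sigma_finite_lborel\<close>)
  also have "\<dots> = density (lborel \<Otimes>\<^sub>M lborel) (\<lambda>p. ennreal (dens2 s (case_prod vec2 p)))"
    by (simp add: dens2_def ennreal_mult split_beta')
  finally show ?thesis
    unfolding gauss2_def
    by (subst lborel_vec2, subst density_distr) (simp_all add: case_prod_beta)
qed

lemma prob_space_gauss2: "0 < s \<Longrightarrow> prob_space (gauss2 s)"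
  unfolding gauss2_eq_distr
  by (intro prob_space.prob_space_distr prob_space_pair prob_space_gauss1) auto

lemma distr_gauss2_nth:
  assumes s: "0 < s"
  shows "distr (gauss2 s) borel (\<lambda>x. x $ i) = gauss1 s"
proof -
  interpret prob_space "gauss1 s" by (rule prob_space_gauss1[OF s])
  interpret pair_prob_space "gauss1 s" "gauss1 s" ..
  have fst: "distr (gauss1 s \<Otimes>\<^sub>M gauss1 s) borel fst = gauss1 s"
    using prob_space.distr_pair_fst[OF prob_space_gauss1[OF s], of "gauss1 s"] by (simp cong: distr_cong)
  have "distr (gauss1 s \<Otimes>\<^sub>M gauss1 s) borel snd = distr (gauss1 s \<Otimes>\<^sub>M gauss1 s) borel fst"
    by (subst distr_pair_swap, subst distr_distr) (auto simp: comp_def split_beta')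
  with fst have snd: "distr (gauss1 s \<Otimes>\<^sub>M gauss1 s) borel snd = gauss1 s" by simp
  have "i = 1 \<or> i = 2" by (rule exhaust_2)
  then show ?thesis
    unfolding gauss2_eq_distr[OF s]
    by (subst distr_distr) (auto simp: comp_def split_beta' fst snd)
qed

definition char_vec :: "'a::euclidean_space measure \<Rightarrow> 'a \<Rightarrow> complex" where
  "char_vec \<mu> t = (\<integral>x. iexp (t \<bullet> x) \<partial>\<mu>)"

lemma normal_density_scale: "0 < s \<Longrightarrow> s * normal_density 0 s (s * x) = std_normal_density x"
  by (simp add: normal_density_def real_sqrt_mult power_mult_distrib)

lemma char_gauss1:
  assumes s: "0 < s"
  shows "char (gauss1 s) t = of_real (exp (- (s * t)\<^sup>2 / 2))"
proof -
  have "char (gauss1 s) t = (\<integral>x. normal_density 0 s x *\<^sub>R iexp (t * x) \<partial>lborel)"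
    unfolding char_def gauss1_def by (rule integral_density) auto
  also have "\<dots> = \<bar>s\<bar> *\<^sub>R (\<integral>x. normal_density 0 s (0 + s * x) *\<^sub>R iexp (t * (0 + s * x)) \<partial>lborel)"
    by (rule lborel_integral_real_affine) (use s in auto)
  also have "\<dots> = (\<integral>x. std_normal_density x *\<^sub>R iexp ((s * t) * x) \<partial>lborel)"
    using s unfolding integral_scaleR_right[symmetric]
    by (simp add: normal_density_scale[symmetric] mult_ac)
  also have "\<dots> = char std_normal_distribution (s * t)"
    unfolding char_def by (rule integral_density[symmetric]) auto
  finally show ?thesis by (simp only: char_std_normal_distribution)
qed

lemma char_gauss2:
  assumes s: "0 < s"
  shows "char_vec (gauss2 s) t = of_real (exp (- (s * norm t)\<^sup>2 / 2))"
proof -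
  interpret prob_space "gauss1 s" by (rule prob_space_gauss1[OF s])
  interpret P: pair_prob_space "gauss1 s" "gauss1 s" ..
  have "char_vec (gauss2 s) t = (\<integral>p. iexp (t $ 1 * fst p) * iexp (t $ 2 * snd p) \<partial>(gauss1 s \<Otimes>\<^sub>M gauss1 s))"
    unfolding char_vec_def gauss2_eq_distr[OF s]
    by (subst integral_distr) (auto simp: inner_vec2 split_beta' exp_add distrib_left)
  also have "\<dots> = (\<integral>x. \<integral>y. iexp (t $ 1 * x) * iexp (t $ 2 * y) \<partial>gauss1 s \<partial>gauss1 s)"
    by (subst P.integral_fst'[symmetric])
      (auto intro!: P.integrable_const_bound[where B = 1] simp: norm_mult simp del: of_real_mult)
  also have "\<dots> = char (gauss1 s) (t $ 1) * char (gauss1 s) (t $ 2)"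
    by (simp add: char_def)
  also have "\<dots> = of_real (exp (- (s * norm t)\<^sup>2 / 2))"
    unfolding char_gauss1[OF s] of_real_mult[symmetric] exp_add[symmetric]
    by (simp only: power_mult_distrib norm_vec2_sq ring_distribs add_divide_distrib minus_add_distrib)
  finally show ?thesis .
qed

lemma dens2_eq: "dens2 s x = exp (- (norm x / s)\<^sup>2 / 2) / (2 * pi * s\<^sup>2)"
proof -
  have "dens2 s x = exp (- (x $ 1)\<^sup>2 / (2 * s\<^sup>2) + - (x $ 2)\<^sup>2 / (2 * s\<^sup>2)) / (sqrt (2 * pi * s\<^sup>2))\<^sup>2"
    unfolding dens2_def normal_density_def exp_add by (simp add: power2_eq_square)
  also have "- (x $ 1)\<^sup>2 / (2 * s\<^sup>2) + - (x $ 2)\<^sup>2 / (2 * s\<^sup>2) = - (norm x / s)\<^sup>2 / 2"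
    by (simp add: power_divide norm_vec2_sq add_divide_distrib)
  finally show ?thesis by simp
qed

text \<open>Self-duality of the Gaussian: up to a constant its density is a Gaussian characteristic
  function. This takes the place of Fourier inversion.\<close>

lemma dens2_char:
  assumes s: "0 < s"
  shows "complex_of_real (dens2 s x) = of_real (1 / (2 * pi * s\<^sup>2)) * char_vec (gauss2 1) (x /\<^sub>R s)"
proof -
  have "norm (x /\<^sub>R s) = norm x / s"
    using s by (simp add: divide_inverse_commute)
  then show ?thesis
    unfolding char_gauss2[OF zero_less_one] of_real_mult[symmetric] dens2_eq by simp
qed

text \<open>Each coordinate contributes the absolute moment \<open>s * sqrt (2 / pi)\<close>, which
  is at most \<open>s\<close>. The bound measures the cost of smoothing a Lipschitz
  function.\<close>

lemma integral_norm_gauss2_le: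
  assumes s: "0 < s"
  shows "integrable (gauss2 s) norm" "(\<integral>x. norm x \<partial>gauss2 s) \<le> 2 * s"
proof -
  interpret prob_space "gauss2 s" by (rule prob_space_gauss2[OF s])
  have hb: "has_bochner_integral lborel (\<lambda>x. normal_density 0 s x * \<bar>x\<bar>) (s * sqrt (2 / pi))"
    using s normal_moment_abs_odd[where \<mu> = 0 and \<sigma> = s and k = 0] by (simp add: real_sqrt_divide)
  have "integrable (gauss1 s) abs"
    unfolding gauss1_def by (subst integrable_density) (use hb in \<open>auto simp: has_bochner_integral_iff\<close>)
  then have i: "integrable (gauss2 s) (\<lambda>x. \<bar>x $ i\<bar>)" for i
    unfolding distr_gauss2_nth[OF s, symmetric, of i] by (subst (asm) integrable_distr_eq) auto
  have "(\<integral>x. \<bar>x\<bar> \<partial>gauss1 s) = s * sqrt (2 / pi)"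
    unfolding gauss1_def by (subst integral_density) (use hb in \<open>auto simp: has_bochner_integral_iff\<close>)
  also have "\<dots> \<le> s * 1"
    using s pi_ge_two by (intro mult_left_mono) auto
  finally have *: "(\<integral>x. \<bar>x\<bar> \<partial>gauss1 s) \<le> s" by simp
  have e: "(\<integral>x. \<bar>x $ i\<bar> \<partial>gauss2 s) \<le> s" for i
    using * unfolding distr_gauss2_nth[OF s, symmetric, of i] by (subst (asm) integral_distr) auto
  show n: "integrable (gauss2 s) norm"
    by (rule Bochner_Integration.integrable_bound[OF Bochner_Integration.integrable_add[OF i[of 1] i[of 2]]])
      (auto intro: norm_vec2_le)
  have "(\<integral>x. norm x \<partial>gauss2 s) \<le> (\<integral>x. \<bar>x $ 1\<bar> + \<bar>x $ 2\<bar> \<partial>gauss2 s)"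
    by (rule integral_mono[OF n]) (use i norm_vec2_le in auto)
  also have "\<dots> \<le> 2 * s"
    using e[of 1] e[of 2] i by simp
  finally show "(\<integral>x. norm x \<partial>gauss2 s) \<le> 2 * s" .
qed

text \<open>Markov's inequality for the fourth moment. The constant is 2 * 3 + 2 * 3: each
  coordinate has fourth moment \<open>3 * s ^ 4\<close>, and the fourth power of the norm is at most
  twice the sum of the fourth powers of the coordinates.\<close>

lemma gauss2_tail:
  assumes s: "0 < s" and c: "0 < c"
  shows "measure (gauss2 s) {x. c \<le> norm x} \<le> 12 * s ^ 4 / c ^ 4"
proof -
  interpret prob_space "gauss2 s" by (rule prob_space_gauss2[OF s])
  have hb: "has_bochner_integral lborel (\<lambda>x. normal_density 0 s x * x ^ 4) (3 * s ^ 4)"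
  proof -
    have "fact (2 * 2) / ((2 / s\<^sup>2)\<^sup>2 * fact 2) = 3 * s ^ 4"
      using s by (simp add: fact_numeral power_divide power_mult[symmetric])
    then show ?thesis using s normal_moment_even[where \<mu> = 0 and \<sigma> = s and k = 2] by simp
  qed
  have "integrable (gauss1 s) (\<lambda>x. x ^ 4)"
    unfolding gauss1_def by (subst integrable_density) (use hb in \<open>auto simp: has_bochner_integral_iff\<close>)
  then have i: "integrable (gauss2 s) (\<lambda>x. (x $ i) ^ 4)" for i
    unfolding distr_gauss2_nth[OF s, symmetric, of i] by (subst (asm) integrable_distr_eq) auto
  have *: "(\<integral>x. x ^ 4 \<partial>gauss1 s) = 3 * s ^ 4"
    unfolding gauss1_def by (subst integral_density) (use hb in \<open>auto simp: has_bochner_integral_iff\<close>)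
  have e: "(\<integral>x. (x $ i) ^ 4 \<partial>gauss2 s) = 3 * s ^ 4" for i
    using * unfolding distr_gauss2_nth[OF s, symmetric, of i] by (subst (asm) integral_distr) auto
  have le: "norm x ^ 4 \<le> 2 * (x $ 1) ^ 4 + 2 * (x $ 2) ^ 4" for x :: "real^2"
  proof -
    have "norm x ^ 4 = ((x $ 1)\<^sup>2 + (x $ 2)\<^sup>2)\<^sup>2" by (simp flip: norm_vec2_sq)
    also have "\<dots> \<le> 2 * ((x $ 1)\<^sup>2)\<^sup>2 + 2 * ((x $ 2)\<^sup>2)\<^sup>2"
      using zero_le_power2[of "(x $ 1)\<^sup>2 - (x $ 2)\<^sup>2"] by (simp add: power2_diff power2_sum)
    finally show ?thesis by simp
  qed
  have n: "integrable (gauss2 s) (\<lambda>x. norm x ^ 4)"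
    by (rule Bochner_Integration.integrable_bound[of _ "\<lambda>x. 2 * (x $ 1) ^ 4 + 2 * (x $ 2) ^ 4"])
      (auto intro!: i intro: order_trans[OF le])
  have "measure (gauss2 s) {x. c \<le> norm x} \<le> measure (gauss2 s) {x\<in>space (gauss2 s). c ^ 4 \<le> norm x ^ 4}"
    using c by (intro finite_measure_mono) (auto intro: power_mono)
  also have "\<dots> \<le> (\<integral>x. norm x ^ 4 \<partial>gauss2 s) / c ^ 4"
    by (rule integral_Markov_inequality_measure[OF n, of "{}"]) (use c in auto)
  also have "\<dots> \<le> (\<integral>x. 2 * (x $ 1) ^ 4 + 2 * (x $ 2) ^ 4 \<partial>gauss2 s) / c ^ 4"
    by (intro divide_right_mono integral_mono n) (use i le c in auto)
  also have "\<dots> = 12 * s ^ 4 / c ^ 4"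
    using i by (simp add: e)
  finally show ?thesis .
qed

section \<open>Gaussian smoothing and total variation\<close>

text \<open>For \<open>s > 0\<close> and a Borel probability measure \<mu>, the density of the
  convolution of \<mu> with \<open>gauss2 s\<close>.\<close>

definition smooth_dens :: "real \<Rightarrow> (real^2) measure \<Rightarrow> real^2 \<Rightarrow> real" where
  "smooth_dens s \<mu> u = (\<integral>x. dens2 s (u - x) \<partial>\<mu>)"

lemma char_vec_bound:
  assumes "prob_space \<mu>" "sets \<mu> = sets borel"
  shows "norm (char_vec \<mu> t) \<le> 1"
proof -
  interpret prob_space \<mu> by fact
  have "norm (char_vec \<mu> t) \<le> (\<integral>x. norm (iexp (t \<bullet> x)) \<partial>\<mu>)"
    unfolding char_vec_def by (rule integral_norm_bound)
  also have "\<dots> = 1" by (simp add: prob_space)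
  finally show ?thesis .
qed

lemma measurable_char_vec:
  assumes "prob_space \<mu>" and [measurable_cong]: "sets \<mu> = sets borel"
  shows "char_vec \<mu> \<in> borel_measurable borel"
proof -
  interpret prob_space \<mu> by fact
  show ?thesis unfolding char_vec_def by measurable
qed

text \<open>Inserting \<open>dens2_char\<close> for the kernel and exchanging the two integrals (the
  integrand has modulus 1) turns the smoothed density into a Gaussian average of the characteristic
  function of \<mu>.\<close>

lemma smooth_dens_char:
  assumes s: "0 < s" and "prob_space \<mu>" and [measurable_cong]: "sets \<mu> = sets borel"
  shows "complex_of_real (smooth_dens s \<mu> u) = of_real (1 / (2 * pi * s\<^sup>2)) *
     (\<integral>y. iexp ((y \<bullet> u) / s) * char_vec \<mu> (- y /\<^sub>R s) \<partial>gauss2 1)"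
proof -
  interpret \<mu>: prob_space \<mu> by fact
  interpret G: prob_space "gauss2 1" by (rule prob_space_gauss2) simp
  interpret P: pair_prob_space \<mu> "gauss2 1" ..
  let ?c = "1 / (2 * pi * s\<^sup>2)"
  have "complex_of_real (smooth_dens s \<mu> u) = (\<integral>x. of_real ?c * char_vec (gauss2 1) ((u - x) /\<^sub>R s) \<partial>\<mu>)"
    unfolding smooth_dens_def integral_complex_of_real[symmetric] dens2_char[OF s] ..
  also have "\<dots> = of_real ?c * (\<integral>x. \<integral>y. iexp (((u - x) /\<^sub>R s) \<bullet> y) \<partial>gauss2 1 \<partial>\<mu>)"
    by (simp add: char_vec_def)
  also have "(\<integral>x. \<integral>y. iexp (((u - x) /\<^sub>R s) \<bullet> y) \<partial>gauss2 1 \<partial>\<mu>) =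
      (\<integral>y. \<integral>x. iexp (((u - x) /\<^sub>R s) \<bullet> y) \<partial>\<mu> \<partial>gauss2 1)"
    by (rule P.Fubini_integral[symmetric], rule P.integrable_const_bound[where B = 1]) auto
  also have "\<dots> = (\<integral>y. iexp ((y \<bullet> u) / s) * char_vec \<mu> (- y /\<^sub>R s) \<partial>gauss2 1)"
  proof (rule Bochner_Integration.integral_cong[OF refl])
    fix y
    have e: "((u - x) /\<^sub>R s) \<bullet> y = (y \<bullet> u) / s + (- y /\<^sub>R s) \<bullet> x" for x
      using s by (simp add: inner_diff_left inner_commute[of y] field_simps)
    have "iexp (((u - x) /\<^sub>R s) \<bullet> y) = iexp ((y \<bullet> u) / s) * iexp ((- y /\<^sub>R s) \<bullet> x)" for x
      unfolding e by (simp only: of_real_add distrib_left exp_add)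
    then show "(\<integral>x. iexp (((u - x) /\<^sub>R s) \<bullet> y) \<partial>\<mu>) = iexp ((y \<bullet> u) / s) * char_vec \<mu> (- y /\<^sub>R s)"
      by (simp add: char_vec_def)
  qed
  finally show ?thesis .
qed

lemma smooth_dens_nonneg [simp]: "0 \<le> smooth_dens s \<mu> u"
  by (simp add: smooth_dens_def)

lemma dens2_bound: "0 < s \<Longrightarrow> dens2 s x \<le> 1 / (2 * pi * s\<^sup>2)"
  unfolding dens2_eq by (intro divide_right_mono) auto

lemma measurable_smooth_dens:
  assumes "prob_space \<mu>" and [measurable_cong]: "sets \<mu> = sets borel"
  shows "smooth_dens s \<mu> \<in> borel_measurable borel"
proof -
  interpret prob_space \<mu> by fact
  show ?thesis unfolding smooth_dens_def by measurable
qed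

lemma integral_dens2:
  assumes s: "0 < s"
  shows "(\<integral>\<^sup>+u. ennreal (dens2 s (u - x)) \<partial>lborel) = 1"
proof -
  interpret prob_space "gauss2 s" by (rule prob_space_gauss2[OF s])
  have "(\<integral>\<^sup>+u. ennreal (dens2 s (u - x)) \<partial>lborel) = (\<integral>\<^sup>+u. ennreal (dens2 s (u - x)) \<partial>distr lborel borel ((+) x))"
    by (simp add: lborel_distr_plus)
  also have "\<dots> = (\<integral>\<^sup>+u. ennreal (dens2 s u) * indicator UNIV u \<partial>lborel)"
    by (subst nn_integral_distr) auto
  also have "\<dots> = emeasure (gauss2 s) UNIV"
    unfolding gauss2_def by (rule emeasure_density[symmetric]) auto
  finally show ?thesis using emeasure_space_1 by simp
qed

lemma nn_integral_smooth_dens: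
  assumes s: "0 < s" and "prob_space \<mu>" and [measurable_cong]: "sets \<mu> = sets borel"
  shows "(\<integral>\<^sup>+u. ennreal (smooth_dens s \<mu> u) \<partial>lborel) = 1"
proof -
  interpret prob_space \<mu> by fact
  interpret P: pair_sigma_finite \<mu> "lborel :: (real^2) measure" ..
  have "(\<integral>\<^sup>+u. ennreal (smooth_dens s \<mu> u) \<partial>lborel) = (\<integral>\<^sup>+u. \<integral>\<^sup>+x. ennreal (dens2 s (u - x)) \<partial>\<mu> \<partial>lborel)"
    unfolding smooth_dens_def
    by (subst nn_integral_eq_integral)
      (auto intro!: integrable_const_bound[where B = "1 / (2 * pi * s\<^sup>2)"] dens2_bound[OF s])
  also have "\<dots> = (\<integral>\<^sup>+x. \<integral>\<^sup>+u. ennreal (dens2 s (u - x)) \<partial>lborel \<partial>\<mu>)"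
    by (rule P.Fubini') auto
  also have "\<dots> = 1"
    by (simp add: integral_dens2[OF s] emeasure_space_1)
  finally show ?thesis .
qed

lemma integrable_smooth_dens:
  assumes "0 < s" "prob_space \<mu>" "sets \<mu> = sets borel"
  shows "integrable lborel (smooth_dens s \<mu>)"
  using nn_integral_smooth_dens[OF assms] measurable_smooth_dens[OF assms(2,3)]
  by (intro integrableI_bounded) auto

text \<open>Justifies reading \<open>smooth_dens\<close> as the density of a sum of independent
  variables: the inner integral is translated by \<open>x\<close>, then Fubini applies since
  \<open>g\<close> is bounded and each translated kernel has mass 1.\<close>

lemma integral_smooth:
  fixes g :: "real^2 \<Rightarrow> real"
  assumes s: "0 < s" and "prob_space \<mu>" and [measurable_cong]: "sets \<mu> = sets borel"
    and [measurable]: "g \<in> borel_measurable borel" and B: "\<And>x. \<bar>g x\<bar> \<le> B"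
  shows "(\<integral>x. \<integral>y. g (x + y) \<partial>gauss2 s \<partial>\<mu>) = (\<integral>u. g u * smooth_dens s \<mu> u \<partial>lborel)"
proof -
  interpret prob_space \<mu> by fact
  interpret P: pair_sigma_finite \<mu> "lborel :: (real^2) measure" ..
  have "(\<integral>y. g (x + y) \<partial>gauss2 s) = (\<integral>u. g u * dens2 s (u - x) \<partial>lborel)" for x
  proof -
    have "(\<integral>u. g u * dens2 s (u - x) \<partial>lborel) = (\<integral>u. g u * dens2 s (u - x) \<partial>distr lborel borel ((+) x))"
      by (simp add: lborel_distr_plus)
    also have "\<dots> = (\<integral>y. g (x + y) * dens2 s y \<partial>lborel)"
      by (subst integral_distr) auto
    also have "\<dots> = (\<integral>y. g (x + y) \<partial>gauss2 s)"
      unfolding gauss2_def by (subst integral_density) (auto simp: mult_ac)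
    finally show ?thesis ..
  qed
  moreover have "(\<integral>x. \<integral>u. g u * dens2 s (u - x) \<partial>lborel \<partial>\<mu>) = (\<integral>u. \<integral>x. g u * dens2 s (u - x) \<partial>\<mu> \<partial>lborel)"
  proof (rule P.Fubini_integral[symmetric], rule integrableI_bounded)
    have "0 \<le> B" using B[of 0] by linarith
    have "(\<integral>\<^sup>+p. ennreal (norm (case p of (x, u) \<Rightarrow> g u * dens2 s (u - x))) \<partial>(\<mu> \<Otimes>\<^sub>M lborel))
        \<le> (\<integral>\<^sup>+p. ennreal B * (case p of (x, u) \<Rightarrow> ennreal (dens2 s (u - x))) \<partial>(\<mu> \<Otimes>\<^sub>M lborel))"
      using \<open>0 \<le> B\<close> by (intro nn_integral_mono)
        (auto simp: abs_mult ennreal_mult[symmetric] intro!: ennreal_leI mult_right_mono B)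
    also have "\<dots> = ennreal B * (\<integral>\<^sup>+x. \<integral>\<^sup>+u. ennreal (dens2 s (u - x)) \<partial>lborel \<partial>\<mu>)"
      by (subst nn_integral_cmult) (auto simp: lborel.nn_integral_fst[symmetric])
    also have "\<dots> < \<infinity>"
      by (simp add: integral_dens2[OF s] emeasure_space_1)
    finally show "(\<integral>\<^sup>+p. ennreal (norm (case p of (x, u) \<Rightarrow> g u * dens2 s (u - x))) \<partial>(\<mu> \<Otimes>\<^sub>M lborel)) < \<infinity>" .
  qed measurable
  ultimately show ?thesis
    by (simp add: smooth_dens_def)
qed

text \<open>In the representation by characteristic functions the integrands are bounded by 1 and
  the integrating measure is a fixed probability measure, so dominated convergence applies
  directly.\<close>

lemma smooth_dens_tendsto:
  assumes s: "0 < s" and p: "\<And>n. prob_space (\<mu> n)" "\<And>n. sets (\<mu> n) = sets borel"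
    and p': "prob_space \<nu>" "sets \<nu> = sets borel"
    and lim: "\<And>t. (\<lambda>n. char_vec (\<mu> n) t) \<longlonglongrightarrow> char_vec \<nu> t"
  shows "(\<lambda>n. smooth_dens s (\<mu> n) u) \<longlonglongrightarrow> smooth_dens s \<nu> u"
proof -
  interpret G: prob_space "gauss2 1" by (rule prob_space_gauss2) simp
  note [measurable] = measurable_char_vec[OF p] measurable_char_vec[OF p']
  have "(\<lambda>n. complex_of_real (smooth_dens s (\<mu> n) u)) \<longlonglongrightarrow> of_real (smooth_dens s \<nu> u)"
    unfolding smooth_dens_char[OF s p] smooth_dens_char[OF s p']
    by (intro tendsto_mult_left integral_dominated_convergence[where w = "\<lambda>_. 1"])
      (auto simp: norm_mult char_vec_bound p p' lim intro!: tendsto_intros simp del: of_real_divide)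
  then show ?thesis by (simp add: tendsto_of_real_iff)
qed

text \<open>Pointwise convergence of the smoothed densities and Scheffe's lemma give convergence in
  total variation of the smoothed laws, hence the uniformity in \<open>g\<close>.\<close>

lemma uniform_lipschitz_convergence:
  fixes \<mu> :: "nat \<Rightarrow> (real^2) measure"
  assumes p: "\<And>n. prob_space (\<mu> n)" "\<And>n. sets (\<mu> n) = sets borel"
    and p': "prob_space \<nu>" "sets \<nu> = sets borel"
    and lim: "\<And>t. (\<lambda>n. char_vec (\<mu> n) t) \<longlonglongrightarrow> char_vec \<nu> t"
    and "0 \<le> B" "0 \<le> L" "0 < e"
  shows "\<forall>\<^sub>F n in sequentially. \<forall>g. (\<forall>x. \<bar>g x\<bar> \<le> B) \<longrightarrow> (\<forall>x y. \<bar>g x - g y\<bar> \<le> L * norm (x - y)) \<longrightarrow>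
     \<bar>(\<integral>x. g x \<partial>\<mu> n) - (\<integral>x. g x \<partial>\<nu>)\<bar> \<le> e"
proof -
  \<comment> \<open>Smoothing an \<open>L\<close>-Lipschitz function costs at most
    \<open>2 * L * s\<close>, here at most \<open>e / 4\<close> for each of the two laws, which
    leaves \<open>e / 2\<close> for total variation. The summand 1 keeps the denominator positive
    when \<open>L = 0\<close>.\<close>
  define s where "s = e / (8 * (L + 1))"
  have s: "0 < s" and Ls: "2 * L * s \<le> e / 4"
    using assms by (auto simp: s_def field_simps)
  interpret G: prob_space "gauss2 s" by (rule prob_space_gauss2[OF s])
  have prob1: "measure (gauss2 s) UNIV = 1" using G.prob_space by simp
  have smooth: "\<bar>(\<integral>x. g x \<partial>\<kappa>) - (\<integral>u. g u * smooth_dens s \<kappa> u \<partial>lborel)\<bar> \<le> e / 4"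
    if k: "prob_space \<kappa>" and sk: "sets \<kappa> = sets borel"
      and g: "\<And>x. \<bar>g x\<bar> \<le> B" "\<And>x y. \<bar>g x - g y\<bar> \<le> L * norm (x - y)"
      and mg: "g \<in> borel_measurable borel" for \<kappa> and g :: "real^2 \<Rightarrow> real"
  proof -
    interpret K: prob_space \<kappa> by fact
    note [measurable] = mg and [measurable_cong] = sk
    have intg: "integrable (gauss2 s) (\<lambda>y. g (x + y))" for x
      by (rule G.integrable_const_bound[where B = B]) (auto simp: g)
    have le: "\<bar>(\<integral>y. g (x + y) \<partial>gauss2 s) - g x\<bar> \<le> e / 4" for x
    proof -
      have "\<bar>(\<integral>y. g (x + y) \<partial>gauss2 s) - g x\<bar> = \<bar>\<integral>y. g (x + y) - g x \<partial>gauss2 s\<bar>"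
        using intg[of x] by (simp add: prob1)
      also have "\<dots> \<le> (\<integral>y. \<bar>g (x + y) - g x\<bar> \<partial>gauss2 s)"
        using integral_norm_bound[of "gauss2 s" "\<lambda>y. g (x + y) - g x"] by simp
      also have "\<dots> \<le> (\<integral>y. L * norm y \<partial>gauss2 s)"
        using intg[of x] integral_norm_gauss2_le[OF s]
        by (intro integral_mono) (auto intro: order_trans[OF g(2)])
      also have "\<dots> \<le> L * (2 * s)"
        using integral_norm_gauss2_le[OF s] \<open>0 \<le> L\<close> by (auto intro: mult_left_mono)
      finally show ?thesis using Ls by (simp add: mult_ac)
    qed
    have i1: "integrable \<kappa> g"
      by (rule K.integrable_const_bound[where B = B]) (auto simp: g)
    have "\<bar>\<integral>y. g (x + y) \<partial>gauss2 s\<bar> \<le> B + e / 4" for x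
      using le[of x] g(1)[of x] by linarith
    then have i2: "integrable \<kappa> (\<lambda>x. \<integral>y. g (x + y) \<partial>gauss2 s)"
      by (intro K.integrable_const_bound[where B = "B + e / 4"]) auto
    have "\<bar>(\<integral>x. g x \<partial>\<kappa>) - (\<integral>x. \<integral>y. g (x + y) \<partial>gauss2 s \<partial>\<kappa>)\<bar>
        = \<bar>\<integral>x. g x - (\<integral>y. g (x + y) \<partial>gauss2 s) \<partial>\<kappa>\<bar>"
      using i1 i2 by simp
    also have "\<dots> \<le> (\<integral>x. \<bar>g x - (\<integral>y. g (x + y) \<partial>gauss2 s)\<bar> \<partial>\<kappa>)"
      using integral_norm_bound[of \<kappa> "\<lambda>x. g x - (\<integral>y. g (x + y) \<partial>gauss2 s)"] by simp
    also have "\<dots> \<le> (\<integral>x. e / 4 \<partial>\<kappa>)"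
      using i1 i2 le by (intro integral_mono) (auto simp: abs_minus_commute)
    finally show ?thesis
      by (simp add: K.prob_space integral_smooth[OF s k sk mg g(1)])
  qed
  let ?p = "\<lambda>n. smooth_dens s (\<mu> n)" and ?q = "smooth_dens s \<nu>"
  note int = integrable_smooth_dens[OF s p] integrable_smooth_dens[OF s p']
  have "(\<lambda>n. \<integral>\<^sup>+u. norm (?p n u - ?q u) \<partial>lborel) \<longlonglongrightarrow> 0"
    using int by (intro Scheffe_lemma2)
      (auto simp: nn_integral_smooth_dens[OF s p] nn_integral_smooth_dens[OF s p']
        intro!: AE_I2 smooth_dens_tendsto s p p' lim)
  moreover have "(\<integral>\<^sup>+u. norm (?p n u - ?q u) \<partial>lborel) = ennreal (\<integral>u. \<bar>?p n u - ?q u\<bar> \<partial>lborel)" for n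
    using int(1)[of n] int(2) by (subst nn_integral_eq_integral) auto
  ultimately have "(\<lambda>n. \<integral>u. \<bar>?p n u - ?q u\<bar> \<partial>lborel) \<longlonglongrightarrow> 0"
    by (simp add: tendsto_ennreal_iff[of _ _ 0, simplified])
  then have "(\<lambda>n. B * (\<integral>u. \<bar>?p n u - ?q u\<bar> \<partial>lborel)) \<longlonglongrightarrow> B * 0"
    by (rule tendsto_mult_left)
  then have "\<forall>\<^sub>F n in sequentially. B * (\<integral>u. \<bar>?p n u - ?q u\<bar> \<partial>lborel) < e / 2"
    by (rule order_tendstoD) (use \<open>0 < e\<close> in simp)
  then show ?thesis
  proof (rule eventually_mono, intro allI impI)
    fix n and g :: "real^2 \<Rightarrow> real"
    assume n: "B * (\<integral>u. \<bar>?p n u - ?q u\<bar> \<partial>lborel) < e / 2"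
      and g: "\<forall>x. \<bar>g x\<bar> \<le> B" "\<forall>x y. \<bar>g x - g y\<bar> \<le> L * norm (x - y)"
    \<comment> \<open>The quantifier over \<open>g\<close> mentions no measurability; it comes from
      the Lipschitz bound.\<close>
    have "L-lipschitz_on UNIV g"
      using g(2) \<open>0 \<le> L\<close> by (auto simp: lipschitz_on_def dist_norm)
    then have mg [measurable]: "g \<in> borel_measurable borel"
      by (intro borel_measurable_continuous_onI lipschitz_on_continuous_on)
    note sm = smooth[OF p g(1)[rule_format] g(2)[rule_format] mg, of n]
      smooth[OF p' g(1)[rule_format] g(2)[rule_format] mg]
    have i: "integrable lborel (\<lambda>u. g u * smooth_dens s \<kappa> u)"
      if "integrable lborel (smooth_dens s \<kappa>)" for \<kappa>
      by (rule Bochner_Integration.integrable_bound[of _ "\<lambda>u. B * smooth_dens s \<kappa> u"])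
        (use that g(1) \<open>0 \<le> B\<close> in \<open>auto simp: abs_mult intro!: mult_right_mono\<close>)
    have "\<bar>(\<integral>u. g u * ?p n u \<partial>lborel) - (\<integral>u. g u * ?q u \<partial>lborel)\<bar> = \<bar>\<integral>u. g u * (?p n u - ?q u) \<partial>lborel\<bar>"
      using i[OF int(1)] i[OF int(2)] by (simp add: right_diff_distrib)
    also have "\<dots> \<le> (\<integral>u. \<bar>g u * (?p n u - ?q u)\<bar> \<partial>lborel)"
      using integral_norm_bound[of lborel "\<lambda>u. g u * (?p n u - ?q u)"] by simp
    also have "\<dots> \<le> (\<integral>u. B * \<bar>?p n u - ?q u\<bar> \<partial>lborel)"
    proof (rule integral_mono)
      show "integrable lborel (\<lambda>u. \<bar>g u * (?p n u - ?q u)\<bar>)"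
        using i[OF int(1), of n] i[OF int(2)]
        unfolding right_diff_distrib by (intro integrable_abs Bochner_Integration.integrable_diff)
      show "integrable lborel (\<lambda>u. B * \<bar>?p n u - ?q u\<bar>)"
        using int(1)[of n] int(2)
        by (intro integrable_mult_right integrable_abs Bochner_Integration.integrable_diff)
      show "\<bar>g u * (?p n u - ?q u)\<bar> \<le> B * \<bar>?p n u - ?q u\<bar>" for u
        unfolding abs_mult using g(1) by (intro mult_right_mono) auto
    qed
    also have "\<dots> < e / 2" using n by simp
    finally show "\<bar>(\<integral>x. g x \<partial>\<mu> n) - (\<integral>x. g x \<partial>\<nu>)\<bar> \<le> e"
      using sm by linarith
  qed
qed

section \<open>Independent increments\<close>

text \<open>\<open>F\<close> lives on all sequences, but the bound forces it to depend on the first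
  \<open>m\<close> coordinates only. Hence it is insensitive to the value \<open>undefined\<close>
  that points of a product over \<open>{..<m}\<close> take elsewhere.\<close>

definition lip_coord :: "nat \<Rightarrow> real \<Rightarrow> real \<Rightarrow> ((nat \<Rightarrow> real^2) \<Rightarrow> real) \<Rightarrow> bool" where
  "lip_coord m B L F \<longleftrightarrow> (\<forall>x. \<bar>F x\<bar> \<le> B) \<and> (\<forall>x y. \<bar>F x - F y\<bar> \<le> L * (\<Sum>i<m. norm (x i - y i)))"

lemma lip_coordD:
  assumes "lip_coord m B L F"
  shows "\<bar>F x\<bar> \<le> B" "\<bar>F x - F y\<bar> \<le> L * (\<Sum>i<m. norm (x i - y i))"
  using assms by (auto simp: lip_coord_def)

lemma lip_coord_cong:
  assumes "lip_coord m B L F" "\<And>i. i < m \<Longrightarrow> x i = y i"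
  shows "F x = F y"
  using lip_coordD(2)[OF assms(1), of x y] assms(2) by simp

text \<open>The bounding sum involves finitely many coordinates, so it is continuous for the product
  topology and vanishes at \<open>x\<close>.\<close>

lemma lip_coord_continuous:
  assumes "lip_coord m B L F"
  shows "continuous_on UNIV F"
proof -
  have "isCont F x" for x
  proof -
    have "continuous_on UNIV (\<lambda>y::nat \<Rightarrow> real^2. L * (\<Sum>i<m. norm (y i - x i)))"
      by (intro continuous_intros continuous_on_product_coordinates)
    then have "isCont (\<lambda>y. L * (\<Sum>i<m. norm (y i - x i))) x"
      by (simp add: continuous_on_eq_continuous_at)
    then have "((\<lambda>y. L * (\<Sum>i<m. norm (y i - x i))) \<longlongrightarrow> 0) (at x)"
      by (simp add: isCont_def)
    moreover have "\<forall>\<^sub>F y in at x. norm (F y - F x) \<le> L * (\<Sum>i<m. norm (y i - x i))"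
      using lip_coordD(2)[OF assms] by (intro always_eventually) simp
    ultimately have "((\<lambda>y. F y - F x) \<longlongrightarrow> 0) (at x)"
      by (rule Lim_null_comparison[rotated])
    then show ?thesis by (simp add: isCont_def LIM_zero_iff)
  qed
  then show ?thesis by (simp add: continuous_on_eq_continuous_at)
qed

lemma lip_coord_measurable:
  assumes F: "lip_coord m B L F" and X: "\<And>i. i < m \<Longrightarrow> X i \<in> borel_measurable M"
  shows "(\<lambda>\<omega>. F (\<lambda>i. X i \<omega>)) \<in> borel_measurable M"
proof -
  \<comment> \<open>Coordinates from \<open>m\<close> on are replaced by 0 because
    \<open>X i\<close> is known to be measurable only for \<open>i < m\<close>; \<open>F\<close>
    does not see the change.\<close>
  have "(\<lambda>\<omega> i. if i < m then X i \<omega> else 0) \<in> borel_measurable M"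
  proof (rule measurable_coordinatewise_then_product)
    show "(\<lambda>\<omega>. if i < m then X i \<omega> else 0) \<in> borel_measurable M" for i
      using X[of i] by (cases "i < m") auto
  qed
  then have "(\<lambda>\<omega>. F (\<lambda>i. if i < m then X i \<omega> else 0)) \<in> borel_measurable M"
    by (rule measurable_compose[OF _ borel_measurable_continuous_onI[OF lip_coord_continuous[OF F]]])
  moreover have "F (\<lambda>i. if i < m then X i \<omega> else 0) = F (\<lambda>i. X i \<omega>)" for \<omega>
    by (rule lip_coord_cong[OF F]) simp
  ultimately show ?thesis by simp
qed

lemma lip_coord_measurable_PiM:
  assumes F: "lip_coord m B L F" and s: "\<And>i. i < m \<Longrightarrow> sets (\<kappa> i) = sets borel"
  shows "F \<in> borel_measurable (PiM {..<m} \<kappa>)"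
proof -
  have "(\<lambda>x. x i) \<in> borel_measurable (PiM {..<m} \<kappa>)" if "i < m" for i
  proof -
    have "(\<lambda>x. x i) \<in> measurable (PiM {..<m} \<kappa>) (\<kappa> i)"
      using that by (intro measurable_component_singleton) auto
    then show ?thesis using s[OF that] measurable_cong_sets by blast
  qed
  from lip_coord_measurable[OF F this] show ?thesis by simp
qed

lemma lip_coord_update:
  assumes F: "lip_coord (Suc m) B L F"
  shows "\<bar>F (x(m := y)) - F (x(m := z))\<bar> \<le> L * norm (y - z)"
  using lip_coordD(2)[OF F, of "x(m := y)" "x(m := z)"] by simp

text \<open>Averaging over a probability measure increases neither the bound nor the Lipschitz
  constant, so the class is stable under integrating out the last coordinate. This drives the
  induction on \<open>m\<close>.\<close>

lemma lip_coord_integral: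
  assumes F: "lip_coord (Suc m) B L F" and k: "prob_space \<kappa>" and [measurable_cong]: "sets \<kappa> = sets borel"
  shows "lip_coord m B L (\<lambda>x. \<integral>y. F (x(m := y)) \<partial>\<kappa>)"
proof -
  interpret prob_space \<kappa> by fact
  have m [measurable]: "(\<lambda>y. F (x(m := y))) \<in> borel_measurable \<kappa>" for x
    using lip_coord_measurable[OF F, of "\<lambda>i y. (x(m := y)) i" \<kappa>] by (auto simp: fun_upd_def)
  have i: "integrable \<kappa> (\<lambda>y. F (x(m := y)))" for x
    by (rule integrable_const_bound[where B = B]) (auto simp: lip_coordD[OF F])
  show ?thesis
    unfolding lip_coord_def
  proof (intro conjI allI)
    fix x
    have "\<bar>\<integral>y. F (x(m := y)) \<partial>\<kappa>\<bar> \<le> (\<integral>y. \<bar>F (x(m := y))\<bar> \<partial>\<kappa>)"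
      using integral_norm_bound[of \<kappa> "\<lambda>y. F (x(m := y))"] by simp
    also have "\<dots> \<le> (\<integral>y. B \<partial>\<kappa>)"
      using i by (intro integral_mono) (auto simp: lip_coordD[OF F])
    finally show "\<bar>\<integral>y. F (x(m := y)) \<partial>\<kappa>\<bar> \<le> B" by (simp add: prob_space)
  next
    fix x y :: "nat \<Rightarrow> real^2"
    have "\<bar>(\<integral>z. F (x(m := z)) \<partial>\<kappa>) - (\<integral>z. F (y(m := z)) \<partial>\<kappa>)\<bar> = \<bar>\<integral>z. F (x(m := z)) - F (y(m := z)) \<partial>\<kappa>\<bar>"
      using i by simp
    also have "\<dots> \<le> (\<integral>z. \<bar>F (x(m := z)) - F (y(m := z))\<bar> \<partial>\<kappa>)"
      using integral_norm_bound[of \<kappa> "\<lambda>z. F (x(m := z)) - F (y(m := z))"] by simp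
    also have "\<dots> \<le> (\<integral>z. L * (\<Sum>i<m. norm (x i - y i)) \<partial>\<kappa>)"
    proof (rule integral_mono)
      fix z
      show "\<bar>F (x(m := z)) - F (y(m := z))\<bar> \<le> L * (\<Sum>i<m. norm (x i - y i))"
        using lip_coordD(2)[OF F, of "x(m := z)" "y(m := z)"] by simp
    qed (use i in auto)
    finally show "\<bar>(\<integral>z. F (x(m := z)) \<partial>\<kappa>) - (\<integral>z. F (y(m := z)) \<partial>\<kappa>)\<bar> \<le> L * (\<Sum>i<m. norm (x i - y i))"
      by (simp add: prob_space)
  qed
qed

lemma lip_coord_integral_Suc:
  assumes F: "lip_coord (Suc m) B L F" and k: "prob_space \<kappa>" and s: "sets \<kappa> = sets borel"
  shows "(\<integral>x. F x \<partial>PiM {..<Suc m} (\<lambda>_. \<kappa>)) = (\<integral>x. (\<integral>y. F (x(m := y)) \<partial>\<kappa>) \<partial>PiM {..<m} (\<lambda>_. \<kappa>))"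
proof -
  interpret prob_space \<kappa> by fact
  interpret product_prob_space "\<lambda>_. \<kappa>" "UNIV :: nat set" ..
  interpret Q: prob_space "PiM {..<Suc m} (\<lambda>_. \<kappa>)"
    by (rule prob_space_PiM) (rule k)
  have "integrable (PiM {..<Suc m} (\<lambda>_. \<kappa>)) F"
    by (rule Q.integrable_const_bound[where B = B])
      (auto simp: lip_coordD[OF F] lip_coord_measurable_PiM[OF F s])
  then show ?thesis
    unfolding lessThan_Suc by (intro product_integral_insert) auto
qed

text \<open>Lindeberg's replacement of one coordinate at a time. The section of \<open>F\<close> in
  its last coordinate varies with the other coordinates, which is why the one-coordinate convergence
  has to be uniform over bounded Lipschitz functions.\<close>

lemma uniform_lipschitz_convergence_PiM:
  fixes \<mu> :: "nat \<Rightarrow> (real^2) measure"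
  assumes p: "\<And>n. prob_space (\<mu> n)" "\<And>n. sets (\<mu> n) = sets borel"
    and p': "prob_space \<nu>" "sets \<nu> = sets borel"
    and lim: "\<And>t. (\<lambda>n. char_vec (\<mu> n) t) \<longlonglongrightarrow> char_vec \<nu> t"
    and BL: "0 \<le> B" "0 \<le> L" and "0 < e"
  shows "\<forall>\<^sub>F n in sequentially. \<forall>F. lip_coord m B L F \<longrightarrow>
     \<bar>(\<integral>x. F x \<partial>PiM {..<m} (\<lambda>_. \<mu> n)) - (\<integral>x. F x \<partial>PiM {..<m} (\<lambda>_. \<nu>))\<bar> \<le> e"
  using \<open>0 < e\<close>
proof (induction m arbitrary: e)
  case 0
  then show ?case by (simp add: PiM_empty)
next
  case (Suc m)
  then have e: "0 < e / 2" by simp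
  \<comment> \<open>Half of \<open>e\<close> pays for exchanging the law of the last coordinate
    under \<open>?P\<close>; the other half pays for passing from \<open>?P\<close> to
    \<open>?Q\<close> with that coordinate already integrated against \<nu>.\<close>
  from Suc.IH[OF e] uniform_lipschitz_convergence[OF p p' lim BL e]
  show ?case
  proof eventually_elim
    case (elim n)
    show ?case
    proof (intro allI impI)
      fix F assume F: "lip_coord (Suc m) B L F"
      let ?P = "PiM {..<m} (\<lambda>_. \<mu> n)" and ?Q = "PiM {..<m} (\<lambda>_. \<nu>)"
      let ?G = "\<lambda>x. \<integral>y. F (x(m := y)) \<partial>\<mu> n" and ?H = "\<lambda>x. \<integral>y. F (x(m := y)) \<partial>\<nu>"
      interpret P: prob_space ?P by (rule prob_space_PiM) (rule p)
      note lG = lip_coord_integral[OF F p, of n] and lH = lip_coord_integral[OF F p']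
      have i: "integrable ?P ?G" "integrable ?P ?H"
        using lip_coordD(1)[OF lG] lip_coordD(1)[OF lH] lip_coord_measurable_PiM[OF lG p(2)]
          lip_coord_measurable_PiM[OF lH p(2)]
        by (auto intro!: P.integrable_const_bound[where B = B])
      have "\<bar>?G x - ?H x\<bar> \<le> e / 2" for x
        by (rule elim(2)[rule_format]) (rule lip_coordD(1)[OF F] lip_coord_update[OF F])+
      then have "(\<integral>x. \<bar>?G x - ?H x\<bar> \<partial>?P) \<le> (\<integral>x. e / 2 \<partial>?P)"
        using i by (intro integral_mono) auto
      then have "(\<integral>x. \<bar>?G x - ?H x\<bar> \<partial>?P) \<le> e / 2"
        by (simp add: P.prob_space)
      moreover have "\<bar>(\<integral>x. ?G x \<partial>?P) - (\<integral>x. ?H x \<partial>?P)\<bar> \<le> (\<integral>x. \<bar>?G x - ?H x\<bar> \<partial>?P)"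
        using i integral_norm_bound[of ?P "\<lambda>x. ?G x - ?H x"] by simp
      moreover have "\<bar>(\<integral>x. ?H x \<partial>?P) - (\<integral>x. ?H x \<partial>?Q)\<bar> \<le> e / 2"
        by (rule elim(1)[rule_format, OF lH])
      ultimately show "\<bar>(\<integral>x. F x \<partial>PiM {..<Suc m} (\<lambda>_. \<mu> n)) - (\<integral>x. F x \<partial>PiM {..<Suc m} (\<lambda>_. \<nu>))\<bar> \<le> e"
        unfolding lip_coord_integral_Suc[OF F p] lip_coord_integral_Suc[OF F p'] by linarith
    qed
  qed
qed

section \<open>Hulls of partial sums as functions of the steps\<close>

definition walk_hull :: "nat \<Rightarrow> (nat \<Rightarrow> 'a::real_vector) \<Rightarrow> 'a set" where
  "walk_hull m x = convex hull ((\<lambda>j. \<Sum>i<j. x i) ` {..m})"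

lemma walk_hull_in_K20: "walk_hull m x \<in> K20"
  unfolding walk_hull_def
proof (rule convex_hull_in_K20)
  show "compact ((\<lambda>j. \<Sum>i<j. x i) ` {..m})" by (intro finite_imp_compact) simp
  show "0 \<in> (\<lambda>j. \<Sum>i<j. x i) ` {..m}" by (rule image_eqI[of _ _ 0]) auto
qed

text \<open>\<open>lip_K20\<close> puts no sign on its constant; multiplying distance estimates by
  it requires a nonnegative one.\<close>

lemma lip_K20_abs:
  assumes "lip_K20 B C f" shows "lip_K20 B \<bar>C\<bar> f"
  unfolding lip_K20_def
proof (intro conjI ballI)
  fix K L assume K: "K \<in> K20" and L: "L \<in> K20"
  have "\<bar>f K - f L\<bar> \<le> C * hausdorff_dist K L" using assms K L by (auto simp: lip_K20_def)
  also have "\<dots> \<le> \<bar>C\<bar> * hausdorff_dist K L"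
    using hausdorff_dist_nonneg[OF K20D[OF L]] by (intro mult_right_mono) auto
  finally show "\<bar>f K - f L\<bar> \<le> \<bar>C\<bar> * hausdorff_dist K L" .
qed (use assms in \<open>auto simp: lip_K20_def\<close>)

text \<open>Partial sums of the same length differ by at most the sum of the differences of the
  steps, and passing to hulls does not enlarge this distance.\<close>

lemma lip_coord_walk_hull:
  assumes f: "lip_K20 B C f" and "0 \<le> C"
  shows "lip_coord m B C (\<lambda>x. f (walk_hull m x))"
  unfolding lip_coord_def
proof (intro conjI allI)
  fix x y :: "nat \<Rightarrow> real^2"
  have *: "norm ((\<Sum>i<j. x i) - (\<Sum>i<j. y i)) \<le> (\<Sum>i<m. norm (x i - y i))" if "j \<le> m" for j
  proof -
    have "norm ((\<Sum>i<j. x i) - (\<Sum>i<j. y i)) \<le> (\<Sum>i<j. norm (x i - y i))"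
      unfolding sum_subtractf[symmetric] by (rule norm_sum)
    also have "\<dots> \<le> (\<Sum>i<m. norm (x i - y i))"
      using that by (intro sum_mono2) auto
    finally show ?thesis .
  qed
  have "hausdorff_dist (walk_hull m x) (walk_hull m y) \<le> (\<Sum>i<m. norm (x i - y i))"
    unfolding walk_hull_def
  proof (rule hausdorff_dist_convex_hull_le)
    fix p assume "p \<in> (\<lambda>j. \<Sum>i<j. x i) ` {..m}"
    then obtain j where "p = (\<Sum>i<j. x i)" "j \<le> m" by auto
    then show "\<exists>q\<in>(\<lambda>j. \<Sum>i<j. y i) ` {..m}. dist p q \<le> (\<Sum>i<m. norm (x i - y i))"
      using *[of j] by (auto simp: dist_norm intro!: bexI[of _ "\<Sum>i<j. y i"])
  next
    fix p assume "p \<in> (\<lambda>j. \<Sum>i<j. y i) ` {..m}"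
    then obtain j where "p = (\<Sum>i<j. y i)" "j \<le> m" by auto
    then show "\<exists>q\<in>(\<lambda>j. \<Sum>i<j. x i) ` {..m}. dist p q \<le> (\<Sum>i<m. norm (x i - y i))"
      using *[of j] by (auto simp: dist_norm norm_minus_commute intro!: bexI[of _ "\<Sum>i<j. x i"])
  qed auto
  then have "C * hausdorff_dist (walk_hull m x) (walk_hull m y) \<le> C * (\<Sum>i<m. norm (x i - y i))"
    using \<open>0 \<le> C\<close> by (rule mult_left_mono)
  then show "\<bar>f (walk_hull m x) - f (walk_hull m y)\<bar> \<le> C * (\<Sum>i<m. norm (x i - y i))"
    using f walk_hull_in_K20 unfolding lip_K20_def by (meson order_trans)
qed (use f walk_hull_in_K20 in \<open>auto simp: lip_K20_def\<close>)

section \<open>Centred square-integrable walks\<close>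

locale centered_iid = prob_space M for M :: "'a measure" +
  fixes W :: "nat \<Rightarrow> 'a \<Rightarrow> real^2"
  assumes indep: "indep_vars (\<lambda>_. borel) W UNIV"
    and identical: "distr M borel (W k) = distr M borel (W 0)"
    and square_integrable: "integrable M (\<lambda>\<omega>. (norm (W 0 \<omega>))\<^sup>2)"
    and mean_zero: "expectation (W 0) = 0"
begin

text \<open>The quadratic form of the covariance matrix, stated without matrices so that
  one-dimensional results apply to each projection.\<close>

definition qvar :: "real^2 \<Rightarrow> real" where
  "qvar t = expectation (\<lambda>\<omega>. (t \<bullet> W 0 \<omega>)\<^sup>2)"

text \<open>The trace of the covariance matrix, since the mean is zero.\<close>

definition tvar :: real where
  "tvar = expectation (\<lambda>\<omega>. (norm (W 0 \<omega>))\<^sup>2)"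

lemma measurable_W [measurable]: "W k \<in> borel_measurable M"
  using indep by (auto simp: indep_vars_def2)

lemma integrable_W_iff:
  fixes h :: "real^2 \<Rightarrow> 'c::{banach, second_countable_topology}"
  assumes [measurable]: "h \<in> borel_measurable borel"
  shows "integrable M (\<lambda>\<omega>. h (W k \<omega>)) \<longleftrightarrow> integrable M (\<lambda>\<omega>. h (W 0 \<omega>))"
  using integrable_distr_eq[of "W k" M borel h] integrable_distr_eq[of "W 0" M borel h]
  by (simp add: identical[of k])

lemma integral_W:
  fixes h :: "real^2 \<Rightarrow> 'c::{banach, second_countable_topology}"
  assumes [measurable]: "h \<in> borel_measurable borel"
  shows "expectation (\<lambda>\<omega>. h (W k \<omega>)) = expectation (\<lambda>\<omega>. h (W 0 \<omega>))"
  using integral_distr[of "W k" M borel h] integral_distr[of "W 0" M borel h]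
  by (simp add: identical[of k])

lemma integrable_inner_sq: "integrable M (\<lambda>\<omega>. (t \<bullet> W k \<omega>)\<^sup>2)"
proof -
  have "integrable M (\<lambda>\<omega>. (t \<bullet> W 0 \<omega>)\<^sup>2)"
  proof (rule Bochner_Integration.integrable_bound)
    show "integrable M (\<lambda>\<omega>. (norm t)\<^sup>2 * (norm (W 0 \<omega>))\<^sup>2)"
      using square_integrable by simp
    have "(t \<bullet> w)\<^sup>2 \<le> (norm t)\<^sup>2 * (norm w)\<^sup>2" for w
      using power_mono[OF Cauchy_Schwarz_ineq2[of t w], of 2] by (simp add: power_mult_distrib)
    then show "AE \<omega> in M. norm ((t \<bullet> W 0 \<omega>)\<^sup>2) \<le> norm ((norm t)\<^sup>2 * (norm (W 0 \<omega>))\<^sup>2)"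
      by simp
  qed simp
  then show ?thesis by (subst integrable_W_iff[of "\<lambda>w. (t \<bullet> w)\<^sup>2"]) auto
qed

lemma integrable_inner: "integrable M (\<lambda>\<omega>. t \<bullet> W k \<omega>)"
  by (rule square_integrable_imp_integrable[OF _ integrable_inner_sq]) simp

lemma integrable_W: "integrable M (W k)"
proof -
  have "integrable M (\<lambda>\<omega>. norm (W 0 \<omega>))"
    by (rule square_integrable_imp_integrable[OF _ square_integrable]) simp
  then have "integrable M (W 0)" by (simp add: integrable_norm_iff)
  then show ?thesis by (subst integrable_W_iff[of "\<lambda>w. w"]) auto
qed

lemma expectation_inner: "expectation (\<lambda>\<omega>. t \<bullet> W k \<omega>) = 0"
  using integrable_W[of 0] mean_zero by (subst integral_W[of "\<lambda>w. t \<bullet> w"]) auto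

lemma expectation_inner_sq: "expectation (\<lambda>\<omega>. (t \<bullet> W k \<omega>)\<^sup>2) = qvar t"
  unfolding qvar_def by (subst integral_W[of "\<lambda>w. (t \<bullet> w)\<^sup>2"]) auto

lemma indep_inner: "indep_vars (\<lambda>_. borel) (\<lambda>k \<omega>. t \<bullet> W k \<omega>) UNIV"
  by (rule indep_vars_compose2[OF indep]) simp

text \<open>Variances add: independence factorises the cross term and centring makes it
  vanish.\<close>

lemma inner_sum_sq:
  assumes "finite I"
  shows "integrable M (\<lambda>\<omega>. (t \<bullet> (\<Sum>i\<in>I. W i \<omega>))\<^sup>2)
    \<and> expectation (\<lambda>\<omega>. (t \<bullet> (\<Sum>i\<in>I. W i \<omega>))\<^sup>2) = card I * qvar t"
  using assms
proof induction
  case (insert k I)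
  let ?X = "\<lambda>\<omega>. t \<bullet> W k \<omega>" and ?Y = "\<lambda>\<omega>. \<Sum>i\<in>I. t \<bullet> W i \<omega>"
  have ind: "indep_var borel ?X borel ?Y"
    by (rule indep_vars_sum[OF insert(1,2)]) (rule indep_vars_subset[OF indep_inner], simp)
  have iX: "integrable M ?X" and iY: "integrable M ?Y"
    using integrable_inner by auto
  have XY: "integrable M (\<lambda>\<omega>. ?X \<omega> * ?Y \<omega>)" "expectation (\<lambda>\<omega>. ?X \<omega> * ?Y \<omega>) = 0"
    using indep_var_integrable[OF ind iX iY] indep_var_lebesgue_integral[OF ind iX iY]
    by (simp_all add: expectation_inner)
  have eq: "(t \<bullet> (\<Sum>i\<in>insert k I. W i \<omega>))\<^sup>2 = (?X \<omega>)\<^sup>2 + (?Y \<omega>)\<^sup>2 + 2 * (?X \<omega> * ?Y \<omega>)" for \<omega>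
    using insert(1,2) by (simp add: inner_add_right inner_sum_right power2_sum)
  have IH: "integrable M (\<lambda>\<omega>. (?Y \<omega>)\<^sup>2)" "expectation (\<lambda>\<omega>. (?Y \<omega>)\<^sup>2) = card I * qvar t"
    using insert.IH by (simp_all add: inner_sum_right)
  show ?case
    unfolding eq using XY IH integrable_inner_sq[of t k] insert(1,2)
    by (simp add: expectation_inner_sq algebra_simps)
qed simp

lemma norm_sum_sq:
  assumes "finite I"
  shows "integrable M (\<lambda>\<omega>. (norm (\<Sum>i\<in>I. W i \<omega>))\<^sup>2)"
    "expectation (\<lambda>\<omega>. (norm (\<Sum>i\<in>I. W i \<omega>))\<^sup>2) = card I * tvar"
proof -
  have eq: "(norm w)\<^sup>2 = (axis 1 1 \<bullet> w)\<^sup>2 + (axis 2 1 \<bullet> w)\<^sup>2" for w :: "real^2"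
    by (simp add: norm_vec2_sq inner_axis')
  have "tvar = qvar (axis 1 1) + qvar (axis 2 1)"
    unfolding tvar_def eq qvar_def using integrable_inner_sq by (intro Bochner_Integration.integral_add)
  then show "integrable M (\<lambda>\<omega>. (norm (\<Sum>i\<in>I. W i \<omega>))\<^sup>2)"
    "expectation (\<lambda>\<omega>. (norm (\<Sum>i\<in>I. W i \<omega>))\<^sup>2) = card I * tvar"
    unfolding eq using inner_sum_sq[OF assms] by (simp_all add: algebra_simps)
qed

lemma qvar_nonneg: "0 \<le> qvar t" and tvar_nonneg: "0 \<le> tvar"
  by (simp_all add: qvar_def tvar_def)

lemma prob_norm_sum_le:
  assumes "finite I" "0 < c"
  shows "prob {\<omega>\<in>space M. c < norm (\<Sum>i\<in>I. W i \<omega>)} \<le> card I * tvar / c\<^sup>2"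
proof -
  have "prob {\<omega>\<in>space M. c < norm (\<Sum>i\<in>I. W i \<omega>)} \<le> prob {\<omega>\<in>space M. c \<le> \<bar>norm (\<Sum>i\<in>I. W i \<omega>)\<bar>}"
    by (intro finite_measure_mono) auto
  also have "\<dots> \<le> expectation (\<lambda>\<omega>. (norm (\<Sum>i\<in>I. W i \<omega>))\<^sup>2) / c\<^sup>2"
    by (rule second_moment_method) (use norm_sum_sq[OF assms(1)] assms(2) in auto)
  finally show ?thesis by (simp add: norm_sum_sq(2)[OF assms(1)])
qed

text \<open>The Cramer-Wold device: for fixed \<open>t\<close> the projections
  \<open>t \<bullet> W i\<close> obey the scalar central limit theorem, which requires positive
  variance. A degenerate direction is separated off; there the projections vanish almost
  surely.\<close>

lemma char_normalized_sum_tendsto: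
  "(\<lambda>n. expectation (\<lambda>\<omega>. iexp (t \<bullet> (\<Sum>i<n. W i \<omega>) / sqrt (real n)))) \<longlonglongrightarrow> of_real (exp (- qvar t / 2))"
proof (cases "qvar t = 0")
  case True
  have "AE \<omega> in M. (t \<bullet> W i \<omega>)\<^sup>2 = 0" for i
    using integral_nonneg_eq_0_iff_AE[OF integrable_inner_sq[of t i]] expectation_inner_sq[of t i] True by simp
  then have "AE \<omega> in M. \<forall>i. t \<bullet> W i \<omega> = 0"
    by (simp add: AE_all_countable)
  then have "expectation (\<lambda>\<omega>. iexp (t \<bullet> (\<Sum>i<n. W i \<omega>) / sqrt (real n))) = expectation (\<lambda>\<omega>. 1)" for n
    by (intro integral_cong_AE) (auto simp: inner_sum_right)
  then show ?thesis using True by (simp add: prob_space)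
next
  case False
  then have pos: "0 < qvar t" using qvar_nonneg[of t] by simp
  define \<sigma> where "\<sigma> = sqrt (qvar t)"
  have \<sigma>: "0 < \<sigma>" "\<sigma>\<^sup>2 = qvar t" using pos by (simp_all add: \<sigma>_def)
  let ?S = "\<lambda>n \<omega>. (\<Sum>i<n. t \<bullet> W i \<omega>) / sqrt (real n * \<sigma>\<^sup>2)"
  have "weak_conv_m (\<lambda>n. distr M borel (?S n)) std_normal_distribution"
  proof (rule central_limit_theorem_zero_mean)
    show "distr M borel (\<lambda>\<omega>. t \<bullet> W k \<omega>) = distr M borel (\<lambda>\<omega>. t \<bullet> W 0 \<omega>)" for k
    proof -
      have "distr M borel (\<lambda>\<omega>. t \<bullet> W k \<omega>) = distr (distr M borel (W k)) borel ((\<bullet>) t)" for k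
        by (subst distr_distr) (auto simp: comp_def)
      then show ?thesis by (metis identical)
    qed
  qed (use \<sigma> indep_inner expectation_inner integrable_inner_sq in \<open>auto simp: expectation_inner_sq\<close>)
  \<comment> \<open>Evaluation at \<sigma> cancels the \<sigma> in the normalisation of
    \<open>?S\<close> and produces the variance in the exponent of the limit.\<close>
  then have "(\<lambda>n. char (distr M borel (?S n)) \<sigma>) \<longlonglongrightarrow> char std_normal_distribution \<sigma>"
    by (intro levy_continuity1) (auto intro!: real_distribution_distr real_dist_normal_dist)
  moreover have "char (distr M borel (?S n)) \<sigma> = expectation (\<lambda>\<omega>. iexp (t \<bullet> (\<Sum>i<n. W i \<omega>) / sqrt (real n)))" for n
    unfolding char_def using \<sigma>
    by (subst integral_distr) (auto simp: inner_sum_right real_sqrt_mult simp flip: \<sigma>(2) simp del: of_real_mult of_real_divide of_real_sum)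
  ultimately show ?thesis
    by (simp add: char_std_normal_distribution \<sigma>(2) del: of_real_exp)
qed

lemma iexp_lipschitz: "norm (iexp x - iexp y) \<le> \<bar>x - y\<bar>"
proof -
  have "iexp x - iexp y = iexp y * (iexp (x - y) - 1)"
    by (simp add: right_diff_distrib exp_add[symmetric] distrib_left[symmetric])
  then have "norm (iexp x - iexp y) = norm (iexp (x - y) - 1)" by (simp add: norm_mult)
  also have "\<dots> \<le> \<bar>x - y\<bar>" using iexp_approx1[of "x - y" 0] by simp
  finally show ?thesis .
qed

text \<open>The block has \<open>n div m\<close> terms but is scaled by \<open>1 / sqrt n\<close>.
  The ratio \<open>c n\<close> of the two normalisations tends to \<open>1 / sqrt m\<close>;
  replacing it by its limit is a Slutsky argument, with second moments bounded uniformly in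
  \<open>n\<close>.\<close>

lemma char_block_sum_tendsto:
  assumes m: "0 < m"
  shows "(\<lambda>n. char_vec (distr M borel (\<lambda>\<omega>. (1 / sqrt (real n)) *\<^sub>R (\<Sum>i<n div m. W i \<omega>))) t)
    \<longlonglongrightarrow> of_real (exp (- qvar t / (2 * real m)))"
proof -
  define q where "q n = n div m" for n
  define c where "c n = sqrt (real (q n)) / sqrt (real n)" for n
  let ?a = "1 / sqrt (real m)"
  have q: "filterlim q at_top sequentially"
    unfolding q_def using m by (intro filterlim_at_top_div_const_nat)
  have c: "c \<longlonglongrightarrow> ?a"
  proof -
    \<comment> \<open>Squeezed by \<open>n - m \<le> m * q n \<le> n\<close>, divided by
      \<open>m * n\<close>.\<close>
    have "(\<lambda>n. real (q n) / real n) \<longlonglongrightarrow> 1 / real m"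
    proof (rule tendsto_sandwich)
      show "\<forall>\<^sub>F n in sequentially. 1 / real m - 1 / real n \<le> real (q n) / real n"
      proof (rule eventually_sequentiallyI[of 1])
        fix n :: nat assume n: "1 \<le> n"
        have "real n - real m \<le> real m * real (q n)"
        proof -
          have "n mod m < m" using m by simp
          moreover have "m * q n + n mod m = n" unfolding q_def by simp
          ultimately show ?thesis by (metis diff_le_eq add_left_mono less_imp_le of_nat_add of_nat_le_iff of_nat_mult)
        qed
        then have "(real n - real m) / (real m * real n) \<le> (real m * real (q n)) / (real m * real n)"
          by (intro divide_right_mono) auto
        then show "1 / real m - 1 / real n \<le> real (q n) / real n"
          using m n by (simp add: diff_divide_distrib)
      qed
      show "\<forall>\<^sub>F n in sequentially. real (q n) / real n \<le> 1 / real m"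
      proof (rule eventually_sequentiallyI[of 1])
        fix n :: nat assume n: "1 \<le> n"
        have "m * q n \<le> n" by (simp add: q_def)
        then have "real m * real (q n) \<le> real n" by (metis of_nat_le_iff of_nat_mult)
        then show "real (q n) / real n \<le> 1 / real m"
          using m n by (simp add: field_simps)
      qed
      show "(\<lambda>n. 1 / real m - 1 / real n) \<longlonglongrightarrow> 1 / real m"
        using tendsto_diff[OF tendsto_const[of "1 / real m"] lim_1_over_n] by simp
    qed simp
    then have "(\<lambda>n. sqrt (real (q n) / real n)) \<longlonglongrightarrow> sqrt (1 / real m)"
      by (rule tendsto_real_sqrt)
    then show ?thesis by (simp add: c_def[abs_def] real_sqrt_divide)
  qed
  let ?X = "\<lambda>k \<omega>. t \<bullet> (\<Sum>i<k. W i \<omega>) / sqrt (real k)"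
  \<comment> \<open>For positive \<open>k\<close> the second moment equals \<open>qvar t\<close>;
    for \<open>k = 0\<close> division by zero makes \<open>?X\<close> zero, hence an
    inequality.\<close>
  have Xsq: "integrable M (\<lambda>\<omega>. (?X k \<omega>)\<^sup>2)" "expectation (\<lambda>\<omega>. (?X k \<omega>)\<^sup>2) \<le> qvar t" for k
  proof -
    show "integrable M (\<lambda>\<omega>. (?X k \<omega>)\<^sup>2)"
      using inner_sum_sq[of "{..<k}" t] by (simp add: power_divide)
    show "expectation (\<lambda>\<omega>. (?X k \<omega>)\<^sup>2) \<le> qvar t"
      using inner_sum_sq[of "{..<k}" t] qvar_nonneg[of t] by (cases "k = 0") (simp_all add: power_divide)
  qed
  have eq: "char_vec (distr M borel (\<lambda>\<omega>. (1 / sqrt (real n)) *\<^sub>R (\<Sum>i<q n. W i \<omega>))) t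
      = expectation (\<lambda>\<omega>. iexp (c n * ?X (q n) \<omega>))" for n
    unfolding char_vec_def
    by (subst integral_distr) (auto simp: c_def intro!: Bochner_Integration.integral_cong)
  let ?u = "\<lambda>n. expectation (\<lambda>\<omega>. iexp (c n * ?X (q n) \<omega>))"
  let ?v = "\<lambda>n. expectation (\<lambda>\<omega>. iexp (?a * ?X (q n) \<omega>))"
  have diff: "norm (?u n - ?v n) \<le> \<bar>c n - ?a\<bar> * (1 + qvar t)" for n
  proof -
    have i: "integrable M (\<lambda>\<omega>. iexp (d * ?X (q n) \<omega>))" for d
      by (rule integrable_const_bound[where B = 1]) (auto simp del: of_real_mult of_real_divide)
    have "norm (?u n - ?v n) = norm (expectation (\<lambda>\<omega>. iexp (c n * ?X (q n) \<omega>) - iexp (?a * ?X (q n) \<omega>)))"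
      using i[of "c n"] i[of ?a] by (simp only: Bochner_Integration.integral_diff)
    also have "\<dots> \<le> expectation (\<lambda>\<omega>. norm (iexp (c n * ?X (q n) \<omega>) - iexp (?a * ?X (q n) \<omega>)))"
      by (rule integral_norm_bound)
    also have "\<dots> \<le> expectation (\<lambda>\<omega>. \<bar>c n - ?a\<bar> * (1 + (?X (q n) \<omega>)\<^sup>2))"
    proof (rule integral_mono)
      show "integrable M (\<lambda>\<omega>. norm (iexp (c n * ?X (q n) \<omega>) - iexp (?a * ?X (q n) \<omega>)))"
        by (intro integrable_norm Bochner_Integration.integrable_diff i)
      show "integrable M (\<lambda>\<omega>. \<bar>c n - ?a\<bar> * (1 + (?X (q n) \<omega>)\<^sup>2))"
        by (intro integrable_mult_right Bochner_Integration.integrable_add Xsq) simp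
      fix \<omega>
      \<comment> \<open>Trades the first absolute moment for the second moment, which is
        known.\<close>
      have *: "\<bar>x\<bar> \<le> 1 + x\<^sup>2" for x :: real
      proof -
        have "0 \<le> (\<bar>x\<bar> - 1)\<^sup>2" by simp
        then show ?thesis by (simp add: power2_diff)
      qed
      have "norm (iexp (c n * ?X (q n) \<omega>) - iexp (?a * ?X (q n) \<omega>)) \<le> \<bar>c n * ?X (q n) \<omega> - ?a * ?X (q n) \<omega>\<bar>"
        by (rule iexp_lipschitz)
      also have "\<dots> = \<bar>c n - ?a\<bar> * \<bar>?X (q n) \<omega>\<bar>"
        unfolding left_diff_distrib[symmetric] abs_mult ..
      also have "\<dots> \<le> \<bar>c n - ?a\<bar> * (1 + (?X (q n) \<omega>)\<^sup>2)"
        by (intro mult_left_mono *) simp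
      finally show "norm (iexp (c n * ?X (q n) \<omega>) - iexp (?a * ?X (q n) \<omega>)) \<le> \<bar>c n - ?a\<bar> * (1 + (?X (q n) \<omega>)\<^sup>2)" .
    qed
    also have "\<dots> = \<bar>c n - ?a\<bar> * (1 + expectation (\<lambda>\<omega>. (?X (q n) \<omega>)\<^sup>2))"
      using Xsq(1)[of "q n"] unfolding integral_mult_right_zero
      by (subst Bochner_Integration.integral_add) (auto simp: prob_space)
    also have "\<dots> \<le> \<bar>c n - ?a\<bar> * (1 + qvar t)"
      by (intro mult_left_mono add_left_mono Xsq) simp
    finally show ?thesis .
  qed
  have "(\<lambda>n. \<bar>c n - ?a\<bar> * (1 + qvar t)) \<longlonglongrightarrow> \<bar>?a - ?a\<bar> * (1 + qvar t)"
    by (intro tendsto_intros c)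
  then have "(\<lambda>n. \<bar>c n - ?a\<bar> * (1 + qvar t)) \<longlonglongrightarrow> 0" by simp
  then have uv: "(\<lambda>n. ?u n - ?v n) \<longlonglongrightarrow> 0"
    by (rule Lim_null_comparison[rotated]) (simp only: diff eventually_True)
  \<comment> \<open>With the limiting factor moved into the direction, this is the previous limit
    for \<open>?a *\<^sub>R t\<close> along the subsequence of block lengths
    \<open>q n\<close>.\<close>
  have "?v = (\<lambda>k. expectation (\<lambda>\<omega>. iexp ((?a *\<^sub>R t) \<bullet> (\<Sum>i<k. W i \<omega>) / sqrt (real k)))) \<circ> q"
    by (simp add: fun_eq_iff)
  moreover have "qvar (?a *\<^sub>R t) = qvar t / real m"
    using m by (simp add: qvar_def power_mult_distrib power_divide)
  ultimately have "?v \<longlonglongrightarrow> of_real (exp (- qvar t / (2 * real m)))"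
    using filterlim_compose[OF char_normalized_sum_tendsto[of "?a *\<^sub>R t"] q]
    by (simp add: comp_def divide_divide_eq_left mult.commute)
  from tendsto_add[OF uv this] have "?u \<longlonglongrightarrow> of_real (exp (- qvar t / (2 * real m)))"
    by (simp only: diff_add_cancel add_0)
  then show ?thesis
    unfolding eq[symmetric] by (simp only: q_def)
qed

end

section \<open>Ottaviani's inequality and block sums\<close>

lemma sum_block_shift:
  fixes x :: "nat \<Rightarrow> 'b::comm_monoid_add"
  shows "(\<Sum>i<j * q + l. x i) = (\<Sum>i<j. \<Sum>k<q. x (i * q + k)) + (\<Sum>k<l. x (j * q + k))"
proof -
  have shift: "(\<Sum>k<l. x (a + k)) = sum x {a..<a + l}" for a l
    by (simp add: lessThan_atLeast0 sum.atLeastLessThan_shift_0[of x a "a + l"])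
  have "sum x {..<j * q + l} = sum x {0..<j * q} + sum x {j * q..<j * q + l}"
    by (simp add: lessThan_atLeast0 sum.atLeastLessThan_concat)
  then show ?thesis
    by (simp add: shift sum.nat_group lessThan_atLeast0[symmetric])
qed

text \<open>Every vertex of the fine hull lies within \<open>e\<close> of the vertex at the start of
  its block, and every coarse vertex is itself a fine one. The index \<open>j = m\<close> in
  \<open>osc\<close> covers the incomplete block left over when \<open>m\<close> does not divide
  \<open>n\<close>.\<close>

lemma hausdorff_walk_hull_blocks:
  fixes x :: "nat \<Rightarrow> 'b::real_normed_vector"
  assumes q: "0 < q" and n: "m * q \<le> n" "n \<le> m * q + q"
    and osc: "\<And>j l. j \<le> m \<Longrightarrow> l \<le> q \<Longrightarrow> norm (\<Sum>k<l. x (j * q + k)) \<le> e"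
  shows "hausdorff_dist (walk_hull n x) (walk_hull m (\<lambda>j. \<Sum>k<q. x (j * q + k))) \<le> e"
  unfolding walk_hull_def
proof (rule hausdorff_dist_convex_hull_le)
  fix p assume "p \<in> (\<lambda>j. \<Sum>i<j. x i) ` {..n}"
  then obtain k where k: "p = (\<Sum>i<k. x i)" "k \<le> n" by auto
  \<comment> \<open>The minimum assigns all times after \<open>m * q\<close> to the leftover block;
    \<open>n \<le> m * q + q\<close> keeps the offset \<open>l\<close> at most \<open>q\<close>
    there.\<close>
  define j where "j = min (k div q) m"
  define l where "l = k - j * q"
  have "j * q \<le> k"
    unfolding j_def using div_times_less_eq_dividend[of k q] by (metis le_trans min.cobounded1 mult_le_mono1)
  then have kl: "k = j * q + l" by (simp add: l_def)
  have "l \<le> q"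
  proof (cases "k div q \<le> m")
    case True
    then have "j = k div q" by (simp add: j_def)
    then have "l = k mod q" by (simp add: l_def minus_div_mult_eq_mod)
    then show ?thesis using q by (simp add: less_imp_le)
  next
    case False
    then have "j = m" by (simp add: j_def)
    then show ?thesis using k n by (simp add: l_def)
  qed
  then have "dist p (\<Sum>i<j. \<Sum>k<q. x (i * q + k)) \<le> e"
    using osc[of j l] unfolding k(1) kl sum_block_shift by (simp add: dist_norm j_def)
  then show "\<exists>p'\<in>(\<lambda>j. \<Sum>i<j. \<Sum>k<q. x (i * q + k)) ` {..m}. dist p p' \<le> e"
    by (auto simp: j_def)
next
  fix p assume "p \<in> (\<lambda>j. \<Sum>i<j. \<Sum>k<q. x (i * q + k)) ` {..m}"
  then obtain j where j: "p = (\<Sum>i<j. \<Sum>k<q. x (i * q + k))" "j \<le> m" by auto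
  have "p = (\<Sum>i<j * q. x i)"
    using sum_block_shift[of x j q 0] j by simp
  moreover have "j * q \<le> n"
    using j n by (meson le_trans mult_le_mono1)
  moreover have "0 \<le> e" using osc[of 0 0] by simp
  ultimately show "\<exists>p'\<in>(\<lambda>j. \<Sum>i<j. x i) ` {..n}. dist p p' \<le> e"
    by (intro bexI[of _ p]) auto
qed auto

text \<open>The joint law of independent variables is the product law on extensional functions;
  restricting to \<open>{..<m}\<close> does not change \<open>F\<close>.\<close>

lemma (in prob_space) integral_lip_coord_indep:
  assumes m: "0 < m" and F: "lip_coord m B L F"
    and ind: "indep_vars (\<lambda>_. borel) X {..<m}" and law: "\<And>j. j < m \<Longrightarrow> distr M borel (X j) = \<kappa>"
  shows "expectation (\<lambda>\<omega>. F (\<lambda>j. X j \<omega>)) = (\<integral>x. F x \<partial>PiM {..<m} (\<lambda>_. \<kappa>))"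
proof -
  have rv: "X j \<in> borel_measurable M" if "j < m" for j
    using ind that by (simp add: indep_vars_def2)
  then have "distr M (PiM {..<m} (\<lambda>_. borel)) (\<lambda>\<omega>. \<lambda>j\<in>{..<m}. X j \<omega>) = PiM {..<m} (\<lambda>j. distr M borel (X j))"
    using m ind by (subst (asm) indep_vars_iff_distr_eq_PiM') (auto simp: lessThan_empty_iff)
  also have "\<dots> = PiM {..<m} (\<lambda>_. \<kappa>)"
    by (intro PiM_cong refl) (simp add: law)
  finally have *: "PiM {..<m} (\<lambda>_. \<kappa>) = distr M (PiM {..<m} (\<lambda>_. borel)) (\<lambda>\<omega>. \<lambda>j\<in>{..<m}. X j \<omega>)" ..
  have "expectation (\<lambda>\<omega>. F (\<lambda>j. X j \<omega>)) = expectation (\<lambda>\<omega>. F (\<lambda>j\<in>{..<m}. X j \<omega>))"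
    by (intro Bochner_Integration.integral_cong lip_coord_cong[OF F]) auto
  also have "\<dots> = (\<integral>x. F x \<partial>distr M (PiM {..<m} (\<lambda>_. borel)) (\<lambda>\<omega>. \<lambda>j\<in>{..<m}. X j \<omega>))"
    using lip_coord_measurable_PiM[OF F, of "\<lambda>_. borel"] rv
    by (subst integral_distr) (auto intro!: measurable_restrict)
  finally show ?thesis unfolding * .
qed

context centered_iid
begin

text \<open>Reindexing is treated as grouping the variables into the disjoint singletons
  \<open>{a + j}\<close>.\<close>

lemma indep_shift: "indep_vars (\<lambda>_. borel) (\<lambda>i. W (a + i)) UNIV"
proof -
  have "indep_vars (\<lambda>j. PiM {a + j} (\<lambda>_. borel)) (\<lambda>j \<omega>. restrict (\<lambda>i. W i \<omega>) {a + j}) UNIV"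
    by (rule indep_vars_restrict[OF indep]) (auto simp: disjoint_family_on_def)
  then have "indep_vars (\<lambda>_. borel) (\<lambda>j \<omega>. (restrict (\<lambda>i. W i \<omega>) {a + j}) (a + j)) UNIV"
    by (rule indep_vars_compose2) auto
  then show ?thesis by simp
qed

lemma centered_iid_shift: "centered_iid M (\<lambda>i. W (a + i))"
proof (unfold_locales)
  show "indep_vars (\<lambda>_. borel) (\<lambda>i. W (a + i)) UNIV" by (rule indep_shift)
  show "distr M borel (W (a + k)) = distr M borel (W (a + 0))" for k
    by (simp only: identical[of "a + k"] identical[of "a + 0"])
  show "integrable M (\<lambda>\<omega>. (norm (W (a + 0) \<omega>))\<^sup>2)"
    by (subst integrable_W_iff[of "\<lambda>w. (norm w)\<^sup>2"]) (auto simp: square_integrable)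
  show "expectation (W (a + 0)) = 0"
    using mean_zero by (subst integral_W[of "\<lambda>w. w"]) auto
qed

text \<open>The right-hand side depends only on the common law of the steps, so sums over shifted
  blocks of equal length are identically distributed.\<close>

lemma law_sum:
  assumes "0 < q"
  shows "distr M borel (\<lambda>\<omega>. \<Sum>i<q. W i \<omega>)
    = distr (PiM {..<q} (\<lambda>_. distr M borel (W 0))) borel (\<lambda>x. \<Sum>i<q. x i)"
proof -
  have "indep_vars (\<lambda>_. borel) W {..<q}"
    by (rule indep_vars_subset[OF indep]) simp
  then have "distr M (PiM {..<q} (\<lambda>_. borel)) (\<lambda>\<omega>. \<lambda>i\<in>{..<q}. W i \<omega>) = PiM {..<q} (\<lambda>i. distr M borel (W i))"
    using assms by (subst (asm) indep_vars_iff_distr_eq_PiM') (auto simp: lessThan_empty_iff)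
  also have "\<dots> = PiM {..<q} (\<lambda>_. distr M borel (W 0))"
    by (intro PiM_cong identical refl)
  finally have *: "PiM {..<q} (\<lambda>_. distr M borel (W 0))
      = distr M (PiM {..<q} (\<lambda>_. borel)) (\<lambda>\<omega>. \<lambda>i\<in>{..<q}. W i \<omega>)" ..
  show ?thesis
    unfolding * by (subst distr_distr) (auto simp: comp_def intro!: borel_measurable_sum measurable_restrict)
qed

lemma law_block_sum: "distr M borel (\<lambda>\<omega>. \<Sum>i<q. W (a + i) \<omega>) = distr M borel (\<lambda>\<omega>. \<Sum>i<q. W i \<omega>)"
proof (cases "q = 0")
  case False
  interpret S: centered_iid M "\<lambda>i. W (a + i)" by (rule centered_iid_shift)
  show ?thesis
    using False law_sum[of q] S.law_sum[of q] identical[of a] by simp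
qed simp

lemma prob_block_sum: "prob {\<omega>\<in>space M. c < norm (\<Sum>i<q. W (a + i) \<omega>)} = prob {\<omega>\<in>space M. c < norm (\<Sum>i<q. W i \<omega>)}"
proof -
  have "measure (distr M borel (\<lambda>\<omega>. \<Sum>i<q. W (b + i) \<omega>)) {x. c < norm x}
      = prob {\<omega>\<in>space M. c < norm (\<Sum>i<q. W (b + i) \<omega>)}" for b
    by (subst measure_distr) (auto intro!: arg_cong[where f = prob])
  from this[of a] this[of 0] show ?thesis by (simp add: law_block_sum[of a])
qed

text \<open>Split by the first index \<open>l\<close> at which the norm exceeds
  \<open>2 * c\<close>. With probability at least 1/2, independently of that event, the remaining
  sum has norm at most \<open>c\<close>, and then the full sum has norm greater than
  \<open>c\<close>. Adding over the disjoint first-passage events costs the factor 2.\<close>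

lemma ottaviani:
  assumes half: "\<And>l. l \<le> q \<Longrightarrow> prob {\<omega>\<in>space M. c < norm (\<Sum>i\<in>{l..<q}. W i \<omega>)} \<le> 1 / 2"
  shows "prob {\<omega>\<in>space M. \<exists>l\<le>q. 2 * c < norm (\<Sum>i<l. W i \<omega>)}
    \<le> 2 * prob {\<omega>\<in>space M. c < norm (\<Sum>i<q. W i \<omega>)}"
proof -
  let ?S = "\<lambda>l \<omega>. \<Sum>i<l. W i \<omega>" and ?T = "\<lambda>l \<omega>. \<Sum>i\<in>{l..<q}. W i \<omega>"
  \<comment> \<open>\<open>A l\<close> is first passage at \<open>l\<close>, determined by the steps
    below \<open>l\<close>; \<open>C l\<close> involves only the steps from \<open>l\<close>
    on.\<close>
  define A where "A l = {\<omega>\<in>space M. 2 * c < norm (?S l \<omega>) \<and> (\<forall>k\<in>{..<l}. norm (?S k \<omega>) \<le> 2 * c)}" for l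
  define C where "C l = {\<omega>\<in>space M. norm (?T l \<omega>) \<le> c}" for l
  have [measurable]: "A l \<in> events" "C l \<in> events" for l
    unfolding A_def C_def by measurable
  have disj: "disjoint_family_on A {..q}"
  proof (unfold disjoint_family_on_def, intro ballI impI)
    have "A k \<inter> A l = {}" if "k < l" for k l
      using that by (force simp: A_def)
    then show "A k \<inter> A l = {}" if "k \<noteq> l" for k l
      using that by (metis inf_commute nat_neq_iff)
  qed
  have half': "prob (A l) \<le> 2 * prob (A l \<inter> C l)" if "l \<le> q" for l
  proof -
    have mS: "(\<lambda>x::nat \<Rightarrow> real^2. \<Sum>i<k. x i) \<in> borel_measurable (PiM {..<l} (\<lambda>_. borel))" if "k \<le> l" for k
      using that by (intro borel_measurable_sum measurable_component_singleton) auto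
    have ind: "indep_var (PiM {..<l} (\<lambda>_. borel)) (\<lambda>\<omega>. restrict (\<lambda>i. W i \<omega>) {..<l})
        (PiM {l..<q} (\<lambda>_. borel)) (\<lambda>\<omega>. restrict (\<lambda>i. W i \<omega>) {l..<q})"
      by (rule indep_var_restrict[OF indep]) auto
    let ?Xa = "{x\<in>space (PiM {..<l} (\<lambda>_. borel)). 2 * c < norm (\<Sum>i<l. x i :: real^2) \<and> (\<forall>k\<in>{..<l}. norm (\<Sum>i<k. x i) \<le> 2 * c)}"
    let ?Xb = "{x\<in>space (PiM {l..<q} (\<lambda>_. borel)). norm (\<Sum>i\<in>{l..<q}. x i :: real^2) \<le> c}"
    have Xa: "?Xa \<in> sets (PiM {..<l} (\<lambda>_. borel))"
    proof (intro sets.sets_Collect_conj sets.sets_Collect_finite_All)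
      show "{x\<in>space (PiM {..<l} (\<lambda>_. borel)). 2 * c < norm (\<Sum>i<l. x i :: real^2)} \<in> sets (PiM {..<l} (\<lambda>_. borel))"
        using mS[OF order_refl] by measurable
      show "{x\<in>space (PiM {..<l} (\<lambda>_. borel)). norm (\<Sum>i<k. x i :: real^2) \<le> 2 * c} \<in> sets (PiM {..<l} (\<lambda>_. borel))"
        if "k \<in> {..<l}" for k
      proof -
        have "k \<le> l" using that by simp
        from mS[OF this] show ?thesis by measurable
      qed
    qed auto
    have Xb: "?Xb \<in> sets (PiM {l..<q} (\<lambda>_. borel))"
      by measurable
    have sp: "restrict (\<lambda>i. W i \<omega>) I \<in> space (PiM I (\<lambda>_. borel))" for \<omega> I
      by (simp add: space_PiM)
    have sums: "(\<Sum>i<k. (restrict (\<lambda>i. W i \<omega>) {..<l}) i) = ?S k \<omega>" if "k \<le> l" for k \<omega>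
      using that by (intro sum.cong) auto
    have eA: "(\<lambda>\<omega>. restrict (\<lambda>i. W i \<omega>) {..<l}) -` ?Xa \<inter> space M = A l"
      unfolding A_def using sp by (auto simp: sums)
    have eC: "(\<lambda>\<omega>. restrict (\<lambda>i. W i \<omega>) {l..<q}) -` ?Xb \<inter> space M = C l"
      unfolding C_def using sp by auto
    have "(\<lambda>\<omega>. (restrict (\<lambda>i. W i \<omega>) {..<l}, restrict (\<lambda>i. W i \<omega>) {l..<q})) -` (?Xa \<times> ?Xb) \<inter> space M = A l \<inter> C l"
      unfolding eA[symmetric] eC[symmetric] by blast
    then have "prob (A l \<inter> C l) = prob (A l) * prob (C l)"
      using indep_varD[OF ind Xa Xb] eA eC by simp
    moreover have "1 / 2 \<le> prob (C l)"
    proof -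
      have "C l = space M - {\<omega>\<in>space M. c < norm (?T l \<omega>)}" by (auto simp: C_def)
      then show ?thesis using half[OF that] by (simp add: prob_compl)
    qed
    ultimately show ?thesis
      using mult_left_mono[of "1 / 2" "prob (C l)" "prob (A l)"] by simp
  qed
  have "{\<omega>\<in>space M. \<exists>l\<le>q. 2 * c < norm (?S l \<omega>)} \<subseteq> (\<Union>l\<in>{..q}. A l)"
  proof safe
    fix \<omega> l assume \<omega>: "\<omega> \<in> space M" and l: "l \<le> q" "2 * c < norm (?S l \<omega>)"
    define k where "k = (LEAST k. 2 * c < norm (?S k \<omega>))"
    have "2 * c < norm (?S k \<omega>)" unfolding k_def by (rule LeastI[of _ l]) (rule l)
    moreover have "k \<le> l" unfolding k_def by (rule Least_le) (rule l)
    moreover have "norm (?S i \<omega>) \<le> 2 * c" if "i < k" for i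
      using not_less_Least[OF that[unfolded k_def]] by simp
    ultimately show "\<omega> \<in> (\<Union>l\<in>{..q}. A l)" using \<omega> l(1) by (auto simp: A_def intro!: bexI[of _ k])
  qed
  then have "prob {\<omega>\<in>space M. \<exists>l\<le>q. 2 * c < norm (?S l \<omega>)} \<le> prob (\<Union>l\<in>{..q}. A l)"
    by (intro finite_measure_mono) auto
  also have "\<dots> = (\<Sum>l\<le>q. prob (A l))"
    by (rule finite_measure_finite_Union) (use disj in auto)
  also have "\<dots> \<le> (\<Sum>l\<le>q. 2 * prob (A l \<inter> C l))"
    by (rule sum_mono) (simp add: half')
  also have "\<dots> = 2 * prob (\<Union>l\<in>{..q}. A l \<inter> C l)"
    unfolding sum_distrib_left[symmetric]
    by (subst finite_measure_finite_Union) (use disj in \<open>auto simp: disjoint_family_on_def\<close>)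
  also have "\<dots> \<le> 2 * prob {\<omega>\<in>space M. c < norm (?S q \<omega>)}"
  proof -
    have "c < norm (?S q \<omega>)" if "l \<le> q" "\<omega> \<in> A l" "\<omega> \<in> C l" for l \<omega>
    proof -
      have "?S q \<omega> = ?S l \<omega> + ?T l \<omega>"
        using \<open>l \<le> q\<close> by (simp add: lessThan_atLeast0 sum.atLeastLessThan_concat)
      moreover have "2 * c < norm (?S l \<omega>)" "norm (?T l \<omega>) \<le> c"
        using that by (auto simp: A_def C_def)
      ultimately show ?thesis
        using norm_diff_ineq[of "?S l \<omega>" "?T l \<omega>"] by simp
    qed
    then have "(\<Union>l\<in>{..q}. A l \<inter> C l) \<subseteq> {\<omega>\<in>space M. c < norm (?S q \<omega>)}"
      by (auto simp: A_def)
    then show ?thesis by (intro mult_left_mono finite_measure_mono) auto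
  qed
  finally show ?thesis .
qed

text \<open>A union bound over \<open>m + 1\<close> blocks, the last one for the remainder.
  Chebyshev's inequality supplies the hypothesis of Ottaviani's inequality for every tail of a
  block, and stationarity reduces each block to the initial one.\<close>

lemma prob_block_oscillation:
  assumes c: "0 < c" and q: "real q * tvar / c\<^sup>2 \<le> 1 / 2"
  shows "prob {\<omega>\<in>space M. \<exists>j\<in>{..m}. \<exists>l\<in>{..q}. 2 * c < norm (\<Sum>i<l. W (j * q + i) \<omega>)}
    \<le> real (m + 1) * (2 * prob {\<omega>\<in>space M. c < norm (\<Sum>i<q. W i \<omega>)})"
proof -
  have "prob {\<omega>\<in>space M. \<exists>j\<in>{..m}. \<exists>l\<in>{..q}. 2 * c < norm (\<Sum>i<l. W (j * q + i) \<omega>)}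
      = prob (\<Union>j\<in>{..m}. {\<omega>\<in>space M. \<exists>l\<in>{..q}. 2 * c < norm (\<Sum>i<l. W (j * q + i) \<omega>)})"
    by (intro arg_cong[where f = prob]) auto
  also have "\<dots> \<le> (\<Sum>j\<le>m. prob {\<omega>\<in>space M. \<exists>l\<in>{..q}. 2 * c < norm (\<Sum>i<l. W (j * q + i) \<omega>)})"
    by (rule finite_measure_subadditive_finite) auto
  also have "\<dots> \<le> (\<Sum>j\<le>m. 2 * prob {\<omega>\<in>space M. c < norm (\<Sum>i<q. W i \<omega>)})"
  proof (rule sum_mono)
    fix j
    interpret S: centered_iid M "\<lambda>i. W (j * q + i)" by (rule centered_iid_shift)
    have tv: "S.tvar = tvar"
      unfolding S.tvar_def tvar_def by (rule integral_W[of "\<lambda>w. (norm w)\<^sup>2"]) simp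
    have "prob {\<omega>\<in>space M. c < norm (\<Sum>i\<in>{l..<q}. W (j * q + i) \<omega>)} \<le> 1 / 2" if "l \<le> q" for l
    proof -
      have "prob {\<omega>\<in>space M. c < norm (\<Sum>i\<in>{l..<q}. W (j * q + i) \<omega>)} \<le> real (q - l) * tvar / c\<^sup>2"
        using S.prob_norm_sum_le[of "{l..<q}" c] c tv by simp
      also have "\<dots> \<le> real q * tvar / c\<^sup>2"
        using tvar_nonneg by (intro divide_right_mono mult_right_mono) auto
      finally show ?thesis using q by linarith
    qed
    from S.ottaviani[OF this]
    show "prob {\<omega>\<in>space M. \<exists>l\<in>{..q}. 2 * c < norm (\<Sum>i<l. W (j * q + i) \<omega>)}
        \<le> 2 * prob {\<omega>\<in>space M. c < norm (\<Sum>i<q. W i \<omega>)}"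
      unfolding prob_block_sum by (simp add: Bex_def)
  qed
  finally show ?thesis by simp
qed

lemma integral_blocks:
  fixes c :: real
  assumes m: "0 < m" and F: "lip_coord m B L F"
  shows "expectation (\<lambda>\<omega>. F (\<lambda>j. c *\<^sub>R (\<Sum>i<q. W (j * q + i) \<omega>)))
    = (\<integral>x. F x \<partial>PiM {..<m} (\<lambda>_. distr M borel (\<lambda>\<omega>. c *\<^sub>R (\<Sum>i<q. W i \<omega>))))"
proof -
  let ?D = "\<lambda>j \<omega>. c *\<^sub>R (\<Sum>i<q. W (j * q + i) \<omega>)"
  have "indep_vars (\<lambda>j. PiM {j * q..<j * q + q} (\<lambda>_. borel)) (\<lambda>j \<omega>. restrict (\<lambda>i. W i \<omega>) {j * q..<j * q + q}) {..<m}"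
  proof (rule indep_vars_restrict[OF indep])
    have "i div q = j" if "i \<in> {j * q..<j * q + q}" for i j
      using that by (intro div_nat_eqI) (auto simp: mult.commute)
    then show "disjoint_family_on (\<lambda>j. {j * q..<j * q + q}) {..<m}"
      unfolding disjoint_family_on_def by blast
  qed simp
  then have "indep_vars (\<lambda>_. borel) (\<lambda>j \<omega>. c *\<^sub>R (\<Sum>i<q. (restrict (\<lambda>i. W i \<omega>) {j * q..<j * q + q}) (j * q + i))) {..<m}"
    by (rule indep_vars_compose2) auto
  then have "indep_vars (\<lambda>_. borel) ?D {..<m}" by simp
  moreover have "distr M borel (?D j) = distr M borel (\<lambda>\<omega>. c *\<^sub>R (\<Sum>i<q. W i \<omega>))" for j
  proof -
    have "distr M borel (\<lambda>\<omega>. c *\<^sub>R (\<Sum>i<q. W (a + i) \<omega>)) = distr (distr M borel (\<lambda>\<omega>. \<Sum>i<q. W (a + i) \<omega>)) borel ((*\<^sub>R) c)" for a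
      by (subst distr_distr) (auto simp: comp_def)
    from this[of "j * q"] this[of 0] show ?thesis by (simp add: law_block_sum)
  qed
  ultimately show ?thesis
    by (intro integral_lip_coord_indep[OF m F])
qed

end

section \<open>Square roots of planar covariance matrices\<close>

lemma inner_mult_vec2:
  fixes S :: "real^2^2"
  shows "x \<bullet> (S *v x) = S $ 1 $ 1 * (x $ 1)\<^sup>2 + (S $ 1 $ 2 + S $ 2 $ 1) * (x $ 1 * x $ 2) + S $ 2 $ 2 * (x $ 2)\<^sup>2"
  by (simp add: inner_vec2 matrix_vector_mult_def sum_2 power2_eq_square algebra_simps)

lemma transpose_eq_iff2: "transpose (S :: real^2^2) = S \<longleftrightarrow> S $ 1 $ 2 = S $ 2 $ 1"
  by (auto simp: transpose_def vec_eq_iff forall_2)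

lemma matrix_mult_nth2:
  "((A :: real^2^2) ** B) $ i $ j = A $ i $ 1 * B $ 1 $ j + A $ i $ 2 * B $ 2 $ j"
  by (simp add: matrix_matrix_mult_def sum_2)

text \<open>The determinant inequality comes from testing the form on \<open>(r, -p)\<close> and
  \<open>(w, -r)\<close>, which give \<open>p\<close> and \<open>w\<close> times the determinant. If
  both diagonal entries vanish, \<open>(1, 1)\<close> and \<open>(1, -1)\<close> force
  \<open>r = 0\<close>.\<close>

lemma psd2D:
  fixes S :: "real^2^2"
  assumes sym: "transpose S = S" and psd: "\<And>x. 0 \<le> x \<bullet> (S *v x)"
  shows "0 \<le> S $ 1 $ 1" "0 \<le> S $ 2 $ 2" "(S $ 1 $ 2)\<^sup>2 \<le> S $ 1 $ 1 * S $ 2 $ 2"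
proof -
  define p r w where prw: "p = S $ 1 $ 1" "r = S $ 1 $ 2" "w = S $ 2 $ 2"
  have quad: "0 \<le> p * y\<^sup>2 + 2 * r * (y * z) + w * z\<^sup>2" for y z
    using psd[of "vec2 y z"] sym by (simp add: inner_mult_vec2 transpose_eq_iff2 prw)
  have p: "0 \<le> p" and w: "0 \<le> w" using quad[of 1 0] quad[of 0 1] by auto
  have "0 \<le> p * (p * w - r\<^sup>2)" using quad[of r "- p"] by (simp add: power2_eq_square algebra_simps)
  moreover have "0 \<le> w * (p * w - r\<^sup>2)" using quad[of w "- r"] by (simp add: power2_eq_square algebra_simps)
  moreover have "r = 0" if "p = 0" "w = 0" using quad[of 1 1] quad[of 1 "-1"] that by simp
  ultimately have "r\<^sup>2 \<le> p * w"
    using p w by (cases "p = 0"; cases "w = 0") (auto simp: zero_le_mult_iff mult_le_0_iff)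
  with p w show "0 \<le> S $ 1 $ 1" "0 \<le> S $ 2 $ 2" "(S $ 1 $ 2)\<^sup>2 \<le> S $ 1 $ 1 * S $ 2 $ 2"
    by (simp_all add: prw)
qed

text \<open>By Cayley-Hamilton a square root \<open>A\<close> satisfies \<open>tr A *\<^sub>R A = S + det A *\<^sub>R mat 1\<close>, where
  \<open>det A = sqrt (det S)\<close> and \<open>(tr A)\<^sup>2 = tr S + 2 * det A\<close>.\<close>

lemma ex1_psd_sqrt2:
  fixes S :: "real^2^2"
  assumes sym: "transpose S = S" and psd: "\<And>x. 0 \<le> x \<bullet> (S *v x)"
  shows "\<exists>!A. transpose A = A \<and> (\<forall>x. 0 \<le> x \<bullet> (A *v x)) \<and> A ** A = S"
proof -
  define p r w where prw: "p = S $ 1 $ 1" "r = S $ 1 $ 2" "w = S $ 2 $ 2"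
  have r: "S $ 2 $ 1 = r" using sym by (simp add: transpose_eq_iff2 prw)
  have pw: "0 \<le> p" "0 \<le> w" "r\<^sup>2 \<le> p * w"
    using psd2D[OF sym psd] by (simp_all add: prw)
  \<comment> \<open>\<open>s\<close> and \<open>t\<close> are the determinant and the trace that any
    positive semidefinite root must have.\<close>
  define s where "s = sqrt (p * w - r\<^sup>2)"
  have s: "0 \<le> s" "s\<^sup>2 = p * w - r\<^sup>2" using pw by (simp_all add: s_def)
  define t where "t = sqrt (p + w + 2 * s)"
  have t: "0 \<le> t" "t\<^sup>2 = p + w + 2 * s" using pw s by (simp_all add: t_def)
  have sol: "A $ 1 $ 1 * t = p + s \<and> A $ 2 $ 2 * t = w + s \<and> A $ 1 $ 2 * t = r \<and> A $ 2 $ 1 = A $ 1 $ 2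
      \<and> (t = 0 \<longrightarrow> A = 0)"
    if A: "transpose A = A" "\<forall>x. 0 \<le> x \<bullet> (A *v x)" "A ** A = S" for A
  proof -
    define a b d where abd: "a = A $ 1 $ 1" "b = A $ 1 $ 2" "d = A $ 2 $ 2"
    have b: "A $ 2 $ 1 = b" using A(1) by (simp add: transpose_eq_iff2 abd)
    have ad: "0 \<le> a" "0 \<le> d" "b\<^sup>2 \<le> a * d"
      using psd2D[OF A(1)] A(2) by (simp_all add: abd)
    have eq: "p = a * a + b * b" "r = a * b + b * d" "w = b * b + d * d"
      unfolding prw A(3)[symmetric] matrix_mult_nth2 by (simp_all add: abd b[unfolded abd])
    have "(a * d - b\<^sup>2)\<^sup>2 = s\<^sup>2"
      unfolding s(2) eq by (simp add: power2_eq_square algebra_simps)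
    then have sd: "s = a * d - b\<^sup>2" using ad(3) s(1) by (simp add: power2_eq_iff_nonneg)
    have "(a + d)\<^sup>2 = t\<^sup>2"
      unfolding t(2) sd eq by (simp add: power2_eq_square algebra_simps)
    then have td: "t = a + d" using ad t(1) by (simp add: power2_eq_iff_nonneg)
    have "a * t = p + s" "d * t = w + s" "b * t = r"
      unfolding td sd eq by (simp_all add: power2_eq_square algebra_simps)
    moreover have "A = 0" if "t = 0"
    proof -
      have "a = 0" "d = 0" using that ad td by auto
      then have "b = 0" using ad by simp
      then show ?thesis using \<open>a = 0\<close> \<open>d = 0\<close> b by (simp add: vec_eq_iff forall_2 abd)
    qed
    ultimately show ?thesis using b by (simp add: abd)
  qed
  show ?thesis
  \<comment> \<open>The formula for the root divides by its trace. Trace zero forces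
    \<open>S = 0\<close>, and then 0 is the only root.\<close>
  proof (cases "t = 0")
    case True
    then have "p + w + 2 * s = 0" using t(2) by simp
    then have 0: "p = 0" "w = 0" using pw s(1) by auto
    then have "r = 0" using pw(3) by simp
    then have "S = 0" using 0 r by (simp add: vec_eq_iff forall_2 prw)
    show ?thesis
    proof (rule ex1I[of _ 0])
      show "transpose 0 = (0::real^2^2) \<and> (\<forall>x. 0 \<le> x \<bullet> ((0::real^2^2) *v x)) \<and> 0 ** 0 = S"
        unfolding \<open>S = 0\<close> by (simp add: vec_eq_iff forall_2 transpose_def matrix_mult_nth2)
    qed (use sol True in blast)
  next
    case False
    then have t0: "0 < t" using t(1) by simp
    define A :: "real^2^2" where "A = (\<chi> i j. (S $ i $ j + (if i = j then s else 0)) / t)"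
    have Ant: "A $ 1 $ 1 = (p + s) / t" "A $ 1 $ 2 = r / t" "A $ 2 $ 1 = r / t" "A $ 2 $ 2 = (w + s) / t"
      by (simp_all add: A_def prw r[unfolded prw])
    show ?thesis
    proof (rule ex1I[of _ A], intro conjI allI)
      show "transpose A = A" by (simp add: transpose_eq_iff2 Ant)
      show "0 \<le> x \<bullet> (A *v x)" for x
      proof -
        have "x \<bullet> (A *v x) = (x \<bullet> (S *v x) + s * ((x $ 1)\<^sup>2 + (x $ 2)\<^sup>2)) / t"
          unfolding inner_mult_vec2 Ant r prw[symmetric] by (simp add: add_divide_distrib algebra_simps)
        then show ?thesis using psd[of x] s(1) t0 by simp
      qed
      have tt: "t * t = p + w + 2 * s" and ss: "s * s = p * w - r * r"
        using t(2) s(2) by (simp_all add: power2_eq_square)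
      have "(p + s) * (p + s) + r * r = p * (t * t)" "(p + s) * r + r * (w + s) = r * (t * t)"
        "r * (p + s) + (w + s) * r = r * (t * t)" "r * r + (w + s) * (w + s) = w * (t * t)"
        unfolding tt by (simp_all add: algebra_simps ss)
      then have "(A ** A) $ 1 $ 1 = p" "(A ** A) $ 1 $ 2 = r" "(A ** A) $ 2 $ 1 = r" "(A ** A) $ 2 $ 2 = w"
        using t0 unfolding matrix_mult_nth2 Ant
        by (simp_all add: add_divide_distrib[symmetric] nonzero_divide_eq_eq)
      then show "A ** A = S" using r by (simp add: vec_eq_iff forall_2 prw)
    next
      fix A' assume "transpose A' = A' \<and> (\<forall>x. 0 \<le> x \<bullet> (A' *v x)) \<and> A' ** A' = S"
      then have "A' $ 1 $ 1 * t = p + s" "A' $ 2 $ 2 * t = w + s" "A' $ 1 $ 2 * t = r" "A' $ 2 $ 1 = A' $ 1 $ 2"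
        using sol by blast+
      then have "A' $ 1 $ 1 = A $ 1 $ 1" "A' $ 2 $ 2 = A $ 2 $ 2" "A' $ 1 $ 2 = A $ 1 $ 2" "A' $ 2 $ 1 = A $ 2 $ 1"
        using t0 unfolding Ant by (auto simp: eq_divide_eq)
      then show "A' = A" by (simp add: vec_eq_iff forall_2)
    qed
  qed
qed

lemma psd_sqrt2:
  fixes S :: "real^2^2"
  assumes "transpose S = S" "\<And>x. 0 \<le> x \<bullet> (S *v x)"
  shows "transpose (psd_sqrt S) = psd_sqrt S" "psd_sqrt S ** psd_sqrt S = S"
  using theI'[OF ex1_psd_sqrt2[OF assms]] unfolding psd_sqrt_def by auto

section \<open>Discretisation of the hull of a continuous path\<close>

lemma hausdorff_walk_hull_path:
  fixes g :: "real \<Rightarrow> 'b::real_normed_vector"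
  assumes g: "continuous_on {0..1} g" "g 0 = 0"
  shows "(\<lambda>m. hausdorff_dist (walk_hull m (\<lambda>j. g (real (Suc j) / real m) - g (real j / real m)))
      (convex hull (g ` {0..1}))) \<longlonglongrightarrow> 0"
proof (rule LIMSEQ_I)
  fix e :: real assume "0 < e"
  have "uniformly_continuous_on {0..1} g"
    by (rule compact_uniformly_continuous[OF g(1)]) simp
  then obtain d where d: "0 < d" "\<And>s s'. s \<in> {0..1} \<Longrightarrow> s' \<in> {0..1} \<Longrightarrow> dist s' s < d \<Longrightarrow> dist (g s') (g s) < e / 2"
    using \<open>0 < e\<close> unfolding uniformly_continuous_on_def by (meson half_gt_zero)
  obtain m0 where m0: "1 / d < real m0" using reals_Archimedean2 by blast
  show "\<exists>m0. \<forall>m\<ge>m0. norm (hausdorff_dist (walk_hull m (\<lambda>j. g (real (Suc j) / real m) - g (real j / real m)))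
      (convex hull (g ` {0..1})) - 0) < e"
  proof (intro exI allI impI)
    fix m assume "m0 \<le> m"
    then have "1 / d < real m" using m0 by linarith
    moreover from this have m: "0 < real m" using d by (meson less_trans zero_less_divide_1_iff)
    ultimately have md: "1 / real m < d" using d by (simp add: field_simps)
    \<comment> \<open>Since \<open>g 0 = 0\<close>, the partial sums of the increments are exactly
      the values of \<open>g\<close> on the grid.\<close>
    have tele: "(\<Sum>i<j. g (real (Suc i) / real m) - g (real i / real m)) = g (real j / real m)" for j
      using sum_lessThan_telescope[of "\<lambda>i. g (real i / real m)" j] g(2) by simp
    have H: "walk_hull m (\<lambda>j. g (real (Suc j) / real m) - g (real j / real m))
        = convex hull ((\<lambda>j. g (real j / real m)) ` {..m})"
      unfolding walk_hull_def tele ..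
    have "hausdorff_dist (convex hull ((\<lambda>j. g (real j / real m)) ` {..m})) (convex hull (g ` {0..1})) \<le> e / 2"
    proof (rule hausdorff_dist_convex_hull_le)
      fix p assume "p \<in> (\<lambda>j. g (real j / real m)) ` {..m}"
      then obtain j where "p = g (real j / real m)" "j \<le> m" by auto
      then show "\<exists>q\<in>g ` {0..1}. dist p q \<le> e / 2"
        using m \<open>0 < e\<close> by (intro bexI[of _ p]) auto
    next
      fix p assume "p \<in> g ` {0..1}"
      then obtain s where s: "p = g s" "0 \<le> s" "s \<le> 1" by auto
      \<comment> \<open>The grid point just below \<open>s\<close>, at distance at most
        \<open>1 / m\<close>; uniform continuity then bounds the distance of the values.\<close>
      define j where "j = nat \<lfloor>s * real m\<rfloor>"
      have j: "real j \<le> s * real m" "s * real m < real j + 1"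
        using s m by (auto simp: j_def)
      have "s * real m \<le> real m" using s m by (simp add: mult_left_le_one_le)
      then have "j \<le> m" using j by linarith
      have "\<bar>s - real j / real m\<bar> \<le> 1 / real m"
      proof -
        have "s - real j / real m = (s * real m - real j) / real m"
          using m by (simp add: diff_divide_distrib)
        moreover have "0 \<le> (s * real m - real j) / real m" "(s * real m - real j) / real m \<le> 1 / real m"
          using j m by (auto intro: divide_right_mono)
        ultimately show ?thesis by simp
      qed
      then have "dist (real j / real m) s < d" using md by (simp add: dist_real_def abs_minus_commute)
      then have "dist (g s) (g (real j / real m)) < e / 2"
        using d(2)[of s "real j / real m"] s m \<open>j \<le> m\<close> by (simp add: dist_commute)
      then show "\<exists>q\<in>(\<lambda>j. g (real j / real m)) ` {..m}. dist p q \<le> e / 2"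
        using \<open>j \<le> m\<close> s(1) by (intro bexI[of _ "g (real j / real m)"]) auto
    qed auto
    moreover have "0 \<le> hausdorff_dist (convex hull ((\<lambda>j. g (real j / real m)) ` {..m})) (convex hull (g ` {0..1}))"
      using g(1) by (intro hausdorff_dist_nonneg bounded_convex_hull compact_imp_bounded compact_continuous_image) auto
    ultimately show "norm (hausdorff_dist (walk_hull m (\<lambda>j. g (real (Suc j) / real m) - g (real j / real m)))
      (convex hull (g ` {0..1})) - 0) < e"
      unfolding H using \<open>0 < e\<close> by simp
  qed
qed

section \<open>Hulls of linear images of planar Brownian motion\<close>

lemma lip_K20D:
  assumes "lip_K20 B C f" "K \<in> K20"
  shows "\<bar>f K\<bar> \<le> B" "L \<in> K20 \<Longrightarrow> \<bar>f K - f L\<bar> \<le> C * hausdorff_dist K L"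
  using assms by (auto simp: lip_K20_def)

lemma eventually_tail_le:
  fixes \<mu> :: "nat \<Rightarrow> (real^2) measure"
  assumes p: "\<And>n. prob_space (\<mu> n)" "\<And>n. sets (\<mu> n) = sets borel"
    and p': "prob_space \<nu>" "sets \<nu> = sets borel"
    and lim: "\<And>t. (\<lambda>n. char_vec (\<mu> n) t) \<longlonglongrightarrow> char_vec \<nu> t"
    and c: "0 < c" and e: "0 < e"
  shows "\<forall>\<^sub>F n in sequentially. measure (\<mu> n) {x. c < norm x} \<le> measure \<nu> {x. c / 2 \<le> norm x} + e"
proof -
  \<comment> \<open>A ramp from 0 at radius \<open>c / 2\<close> to 1 at radius \<open>c\<close>. It
    lies between the two tail indicators and has Lipschitz constant \<open>2 / c\<close>; halving
    the radius is the price for testing tails with a Lipschitz function.\<close>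
  define h where "h x = min 1 (max 0 (2 * norm x / c - 1))" for x :: "real^2"
  have hB: "0 \<le> h x" "h x \<le> 1" "\<bar>h x\<bar> \<le> 1" for x by (auto simp: h_def)
  have hL: "\<bar>h x - h y\<bar> \<le> 2 / c * norm (x - y)" for x y
  proof -
    have "\<bar>h x - h y\<bar> \<le> \<bar>2 * norm x / c - 2 * norm y / c\<bar>" by (auto simp: h_def)
    also have "2 * norm x / c - 2 * norm y / c = 2 / c * (norm x - norm y)"
      by (simp add: right_diff_distrib diff_divide_distrib)
    also have "\<bar>\<dots>\<bar> = 2 / c * \<bar>norm x - norm y\<bar>"
      using c by (simp only: abs_mult) simp
    also have "\<dots> \<le> 2 / c * norm (x - y)"
      using c by (intro mult_left_mono norm_triangle_ineq3) auto
    finally show ?thesis .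
  qed
  have [measurable]: "h \<in> borel_measurable borel" unfolding h_def by measurable
  have lower: "measure \<kappa> {x. c < norm x} \<le> (\<integral>x. h x \<partial>\<kappa>)"
    and upper: "(\<integral>x. h x \<partial>\<kappa>) \<le> measure \<kappa> {x. c / 2 \<le> norm x}"
    if "prob_space \<kappa>" and s: "sets \<kappa> = sets borel" for \<kappa>
  proof -
    interpret prob_space \<kappa> by fact
    note [measurable_cong] = s
    have sp: "space \<kappa> = UNIV" using sets_eq_imp_space_eq[OF s] by simp
    have ih: "integrable \<kappa> h" by (rule integrable_const_bound[where B = 1]) (auto simp: hB)
    have "measure \<kappa> {x. c < norm x} = (\<integral>x. indicator {x. c < norm x} x \<partial>\<kappa>)" by (simp add: sp)
    also have "\<dots> \<le> (\<integral>x. h x \<partial>\<kappa>)"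
    proof (rule integral_mono[OF _ ih])
      show "integrable \<kappa> (indicat_real {x. c < norm x})"
        by (rule integrable_const_bound[where B = 1]) (auto simp: indicator_def)
      show "indicat_real {x. c < norm x} x \<le> h x" for x
        using c by (auto simp: indicator_def h_def field_simps)
    qed
    finally show "measure \<kappa> {x. c < norm x} \<le> (\<integral>x. h x \<partial>\<kappa>)" .
    have "(\<integral>x. h x \<partial>\<kappa>) \<le> (\<integral>x. indicator {x. c / 2 \<le> norm x} x \<partial>\<kappa>)"
    proof (rule integral_mono[OF ih])
      show "integrable \<kappa> (indicat_real {x. c / 2 \<le> norm x})"
        by (rule integrable_const_bound[where B = 1]) (auto simp: indicator_def)
      show "h x \<le> indicat_real {x. c / 2 \<le> norm x} x" for x
        using c by (auto simp: indicator_def h_def field_simps)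
    qed
    also have "\<dots> = measure \<kappa> {x. c / 2 \<le> norm x}" by (simp add: sp)
    finally show "(\<integral>x. h x \<partial>\<kappa>) \<le> measure \<kappa> {x. c / 2 \<le> norm x}" .
  qed
  have "0 \<le> 2 / c" using c by simp
  from uniform_lipschitz_convergence[OF p p' lim zero_le_one this e]
  show ?thesis
  proof (rule eventually_mono)
    fix n
    assume "\<forall>g. (\<forall>x. \<bar>g x\<bar> \<le> 1) \<longrightarrow> (\<forall>x y. \<bar>g x - g y\<bar> \<le> 2 / c * norm (x - y)) \<longrightarrow>
        \<bar>(\<integral>x. g x \<partial>\<mu> n) - (\<integral>x. g x \<partial>\<nu>)\<bar> \<le> e"
    then have "\<bar>(\<integral>x. h x \<partial>\<mu> n) - (\<integral>x. h x \<partial>\<nu>)\<bar> \<le> e" using hB hL by blast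
    with lower[OF p, of n] upper[OF p'] show "measure (\<mu> n) {x. c < norm x} \<le> measure \<nu> {x. c / 2 \<le> norm x} + e"
      by linarith
  qed
qed

text \<open>The matrix moves to the dual variable as its transpose. \<open>A\<close> may be
  singular, so the image law is described by its characteristic function and not by a
  density.\<close>

lemma char_vec_linear_gauss2:
  assumes "0 < s"
  shows "char_vec (distr (gauss2 s) borel ((*v) A)) t = of_real (exp (- (s * norm (transpose A *v t))\<^sup>2 / 2))"
proof -
  have [measurable]: "(*v) A \<in> borel_measurable borel"
    by (intro borel_measurable_continuous_onI linear_continuous_on matrix_vector_mul_bounded_linear)
  have "char_vec (distr (gauss2 s) borel ((*v) A)) t = char_vec (gauss2 s) (transpose A *v t)"
    unfolding char_vec_def transpose_matrix_vector dot_lmul_matrix by (subst integral_distr) auto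
  then show ?thesis by (simp only: char_gauss2[OF assms])
qed

lemma linear_gauss2_tail:
  fixes A :: "real^2^2"
  assumes s: "0 < s" and c: "0 < c" and K: "0 < K" "\<And>x. norm (A *v x) \<le> K * norm x"
  shows "measure (distr (gauss2 s) borel ((*v) A)) {x. c \<le> norm x} \<le> 12 * s ^ 4 / (c / K) ^ 4"
proof -
  have m: "(*v) A \<in> borel_measurable borel"
    by (intro borel_measurable_continuous_onI linear_continuous_on matrix_vector_mul_bounded_linear)
  interpret prob_space "gauss2 s" by (rule prob_space_gauss2[OF s])
  have "measure (distr (gauss2 s) borel ((*v) A)) {x. c \<le> norm x} = measure (gauss2 s) {x. c \<le> norm (A *v x)}"
    using m by (subst measure_distr) (auto intro!: arg_cong[where f = "measure (gauss2 s)"])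
  also have "\<dots> \<le> measure (gauss2 s) {x. c / K \<le> norm x}"
  proof (rule finite_measure_mono)
    have "c \<le> K * norm x" if "c \<le> norm (A *v x)" for x using that K(2)[of x] by linarith
    then show "{x. c \<le> norm (A *v x)} \<subseteq> {x. c / K \<le> norm x}"
      using K(1) by (auto simp: pos_divide_le_eq mult.commute)
  qed simp
  also have "\<dots> \<le> 12 * s ^ 4 / (c / K) ^ 4"
    using c K by (intro gauss2_tail[OF s]) simp
  finally show ?thesis .
qed

locale planar_BM = prob_space N for N :: "'b measure" +
  fixes b :: "'b \<Rightarrow> real \<Rightarrow> real^2" and A :: "real^2^2"
  assumes bm: "std_BM2 N b"
begin

definition incr :: "nat \<Rightarrow> nat \<Rightarrow> 'b \<Rightarrow> real^2" where
  "incr m j \<omega> = A *v b \<omega> (real (Suc j) / real m) - A *v b \<omega> (real j / real m)"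

text \<open>The law of one increment of \<open>A *v b\<close> over a time span \<open>1 / m\<close>,
  for positive \<open>m\<close>.\<close>

definition step_law :: "nat \<Rightarrow> (real^2) measure" where
  "step_law m = distr (gauss2 (1 / sqrt (real m))) borel ((*v) A)"

lemma measurable_A [measurable]: "(*v) A \<in> borel_measurable borel"
  by (intro borel_measurable_continuous_onI linear_continuous_on matrix_vector_mul_bounded_linear)

lemma prob_space_step_law: "0 < m \<Longrightarrow> prob_space (step_law m)"
  unfolding step_law_def by (intro prob_space.prob_space_distr prob_space_gauss2) auto

lemma sets_step_law: "sets (step_law m) = sets borel"
  by (simp add: step_law_def)

lemma incr_eq: "incr m j \<omega> = A *v (b \<omega> (real (Suc j) / real m) - b \<omega> (real j / real m))"
  by (simp add: incr_def matrix_vector_mult_diff_distrib)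

lemma law_incr:
  assumes "j < m"
  shows "incr m j \<in> borel_measurable N" "distr N borel (incr m j) = step_law m"
proof -
  let ?s = "real j / real m" and ?t = "real (Suc j) / real m"
  let ?X = "\<lambda>\<omega>. b \<omega> ?t - b \<omega> ?s"
  have st: "0 \<le> ?s" "?s < ?t" "?t \<le> 1" and d: "?t - ?s = 1 / real m"
    using assms by (auto simp: divide_simps)
  have "distributed N lborel ?X (\<lambda>x. ennreal (normal_density 0 (sqrt (?t - ?s)) (x $ 1) *
      normal_density 0 (sqrt (?t - ?s)) (x $ 2)))"
    using bm st unfolding std_BM2_def by blast
  then have "distributed N lborel ?X (\<lambda>x. ennreal (dens2 (1 / sqrt (real m)) x))"
    unfolding d by (simp add: dens2_def real_sqrt_divide)
  then have X [measurable]: "?X \<in> borel_measurable N" and "distr N lborel ?X = gauss2 (1 / sqrt (real m))"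
    by (auto simp: distributed_def gauss2_def)
  then have law: "distr N borel ?X = gauss2 (1 / sqrt (real m))"
    by (simp cong: distr_cong)
  show "incr m j \<in> borel_measurable N"
    unfolding incr_eq[abs_def] by (rule measurable_compose[OF X measurable_A])
  show "distr N borel (incr m j) = step_law m"
    unfolding incr_eq[abs_def] step_law_def law[symmetric]
    by (subst distr_distr[OF measurable_A X]) (simp add: comp_def)
qed

lemma indep_incr: "indep_vars (\<lambda>_. borel) (incr m) {..<m}"
proof -
  \<comment> \<open>\<open>m + 1\<close> grid points yield the \<open>m\<close> increments in the
    definition of Brownian motion.\<close>
  define ts where "ts = map (\<lambda>j. real j / real m) [0..<Suc m]"
  have len: "length ts - 1 = m" by (simp add: ts_def)
  have nth: "ts ! j = real j / real m" if "j \<le> m" for j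
    using that by (auto simp: ts_def simp del: upt_Suc)
  have "sorted_wrt (<) ts"
    unfolding sorted_wrt_iff_nth_less
  proof (intro allI impI)
    fix i j assume "i < j" "j < length ts"
    then have ij: "i < j" "j \<le> m" by (auto simp: ts_def)
    then have "real i / real m < real j / real m" by (intro divide_strict_right_mono) auto
    then show "ts ! i < ts ! j" using nth[of i] nth[of j] ij by simp
  qed
  moreover have "set ts \<subseteq> {0..1}"
  proof
    fix x assume "x \<in> set ts"
    then obtain j where j: "j < length ts" "x = ts ! j" by (auto simp: in_set_conv_nth)
    then have "j \<le> m" by (simp add: ts_def)
    then have "j \<le> m" "x = real j / real m" using j nth[of j] by auto
    then show "x \<in> {0..1}" by (auto simp: divide_le_eq_1)
  qed
  moreover have "\<forall>ts. sorted_wrt (<) ts \<and> set ts \<subseteq> {0..1} \<longrightarrow>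
      indep_vars (\<lambda>_. borel) (\<lambda>i \<omega>. b \<omega> (ts ! Suc i) - b \<omega> (ts ! i)) {..<length ts - 1}"
    using bm unfolding std_BM2_def by (elim conjE)
  ultimately have "indep_vars (\<lambda>_. borel) (\<lambda>i \<omega>. b \<omega> (ts ! Suc i) - b \<omega> (ts ! i)) {..<length ts - 1}"
    by blast
  then have "indep_vars (\<lambda>_. borel) (\<lambda>i \<omega>. b \<omega> (ts ! Suc i) - b \<omega> (ts ! i)) {..<m}"
    unfolding len .
  then have "indep_vars (\<lambda>_. borel) (\<lambda>i \<omega>. A *v (b \<omega> (ts ! Suc i) - b \<omega> (ts ! i))) {..<m}"
    by (rule indep_vars_compose2[where Y = "\<lambda>_. (*v) A"]) (rule measurable_A)
  moreover have "(\<lambda>\<omega>. A *v (b \<omega> (ts ! Suc i) - b \<omega> (ts ! i))) = incr m i" if "i \<in> {..<m}" for i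
    unfolding incr_eq[abs_def] using nth[of i] nth[of "Suc i"] that by simp
  ultimately show ?thesis
    by (rule indep_vars_cong[THEN iffD1, OF refl _ refl, rotated])
qed

lemma path_A:
  assumes "\<omega> \<in> space N"
  shows "continuous_on {0..1} (\<lambda>s. A *v b \<omega> s)" "A *v b \<omega> 0 = 0"
proof -
  have c: "continuous_on {0..1} (b \<omega>)" "b \<omega> 0 = 0"
    using bm assms unfolding std_BM2_def by blast+
  show "continuous_on {0..1} (\<lambda>s. A *v b \<omega> s)"
    by (rule bounded_linear.continuous_on[OF matrix_vector_mul_bounded_linear c(1)])
  show "A *v b \<omega> 0 = 0" by (simp add: c(2))
qed

definition path_hull :: "'b \<Rightarrow> (real^2) set" where
  "path_hull \<omega> = convex hull ((\<lambda>s. A *v b \<omega> s) ` {0..1})"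

lemma path_hull_in_K20:
  assumes "\<omega> \<in> space N"
  shows "path_hull \<omega> \<in> K20"
  unfolding path_hull_def
proof (rule convex_hull_in_K20)
  show "compact ((\<lambda>s. A *v b \<omega> s) ` {0..1})"
    by (rule compact_continuous_image[OF path_A(1)[OF assms] compact_Icc])
  show "0 \<in> (\<lambda>s. A *v b \<omega> s) ` {0..1}"
    by (rule image_eqI[of _ _ 0]) (use path_A(2)[OF assms] in auto)
qed

lemma lip_path_hull_tendsto:
  assumes f: "lip_K20 B C f" and \<omega>: "\<omega> \<in> space N"
  shows "(\<lambda>m. f (walk_hull m (\<lambda>j. incr m j \<omega>))) \<longlonglongrightarrow> f (path_hull \<omega>)"
proof -
  have "(\<lambda>m. C * hausdorff_dist (walk_hull m (\<lambda>j. incr m j \<omega>)) (path_hull \<omega>)) \<longlonglongrightarrow> C * 0"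
    unfolding incr_def path_hull_def
    by (rule tendsto_mult_left[OF hausdorff_walk_hull_path[OF path_A[OF \<omega>]]])
  then have "(\<lambda>m. C * hausdorff_dist (walk_hull m (\<lambda>j. incr m j \<omega>)) (path_hull \<omega>)) \<longlonglongrightarrow> 0" by simp
  moreover have "\<forall>\<^sub>F m in sequentially. norm (f (walk_hull m (\<lambda>j. incr m j \<omega>)) - f (path_hull \<omega>))
      \<le> C * hausdorff_dist (walk_hull m (\<lambda>j. incr m j \<omega>)) (path_hull \<omega>)"
    unfolding real_norm_def
    by (intro always_eventually allI lip_K20D(2)[OF f] walk_hull_in_K20 path_hull_in_K20 \<omega>)
  ultimately have "(\<lambda>m. f (walk_hull m (\<lambda>j. incr m j \<omega>)) - f (path_hull \<omega>)) \<longlonglongrightarrow> 0"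
    by (rule Lim_null_comparison[rotated])
  then show ?thesis by (simp add: LIM_zero_iff)
qed

lemma measurable_lip_walk_hull_incr:
  assumes f: "lip_K20 B C f"
  shows "(\<lambda>\<omega>. f (walk_hull m (\<lambda>j. incr m j \<omega>))) \<in> borel_measurable N"
  by (rule lip_coord_measurable[OF lip_coord_walk_hull[OF lip_K20_abs[OF f]]]) (simp_all add: law_incr)

text \<open>The hull involves uncountably many times; measurability is inherited from the
  discretised hulls, which depend on finitely many increments.\<close>

lemma measurable_lip_path_hull:
  assumes f: "lip_K20 B C f"
  shows "(\<lambda>\<omega>. f (path_hull \<omega>)) \<in> borel_measurable N"
  by (rule borel_measurable_LIMSEQ_real[OF lip_path_hull_tendsto[OF f] measurable_lip_walk_hull_incr[OF f]])

lemma expectation_lip_path_hull_tendsto: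
  assumes f: "lip_K20 B C f"
  shows "(\<lambda>m. \<integral>x. f (walk_hull m x) \<partial>PiM {..<m} (\<lambda>_. step_law m)) \<longlonglongrightarrow> expectation (\<lambda>\<omega>. f (path_hull \<omega>))"
proof -
  have "(\<lambda>m. expectation (\<lambda>\<omega>. f (walk_hull m (\<lambda>j. incr m j \<omega>)))) \<longlonglongrightarrow> expectation (\<lambda>\<omega>. f (path_hull \<omega>))"
  proof (rule integral_dominated_convergence[where w = "\<lambda>_. B"])
    show "AE \<omega> in N. norm (f (walk_hull m (\<lambda>j. incr m j \<omega>))) \<le> B" for m
      using lip_K20D(1)[OF f walk_hull_in_K20] by simp
  qed (auto simp: measurable_lip_walk_hull_incr[OF f] measurable_lip_path_hull[OF f] lip_path_hull_tendsto[OF f])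
  moreover have "expectation (\<lambda>\<omega>. f (walk_hull m (\<lambda>j. incr m j \<omega>))) = (\<integral>x. f (walk_hull m x) \<partial>PiM {..<m} (\<lambda>_. step_law m))"
    if "0 < m" for m
    using that lip_coord_walk_hull[OF lip_K20_abs[OF f], of m]
    by (intro integral_lip_coord_indep indep_incr law_incr) auto
  ultimately show ?thesis
    by (rule Lim_transform_eventually[OF _ eventually_mono[OF eventually_gt_at_top[of "0::nat"]]])
qed

end

section \<open>Weak convergence of the hulls\<close>

text \<open>Outside the oscillation event the hulls are within \<open>d\<close>, which costs
  \<open>C * d\<close>; on the event the boundedness of \<open>f\<close> costs \<open>2 * B\<close>.
  The condition \<open>m * m \<le> n\<close> makes the remainder \<open>n mod m\<close> no longer
  than a block.\<close>

lemma (in centered_iid) coarse_grained_hull_error: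
  assumes f: "lip_K20 B C f" and C: "0 \<le> C" and d: "0 < d" and m: "0 < m" and n: "m * m \<le> n"
    and var: "4 * tvar / d\<^sup>2 / real m \<le> 1 / 2"
  defines "c \<equiv> 1 / sqrt (real n)"
  shows "\<bar>expectation (\<lambda>\<omega>. f (walk_hull n (\<lambda>i. c *\<^sub>R W i \<omega>)))
      - expectation (\<lambda>\<omega>. f (walk_hull m (\<lambda>j. c *\<^sub>R (\<Sum>i<n div m. W (j * (n div m) + i) \<omega>))))\<bar>
    \<le> C * d + 2 * B * (real (m + 1) * (2 * prob {\<omega>\<in>space M. d / 2 < norm (c *\<^sub>R (\<Sum>i<n div m. W i \<omega>))}))"
proof -
  define q where "q = n div m"
  have "0 < n" using n m by (cases "n = 0") auto
  then have c: "0 < c" and c2: "c\<^sup>2 = 1 / real n" by (simp_all add: c_def power_divide)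
  have mq: "m \<le> q" using n m by (simp add: q_def less_eq_div_iff_mult_less_eq)
  have nm: "n = m * q + n mod m" by (simp add: q_def)
  have n1: "m * q \<le> n" "n \<le> m * q + q"
    using nm mq mod_less_divisor[OF m, of n] by linarith+
  have B: "0 \<le> B" using lip_K20D(1)[OF f walk_hull_in_K20[of 0 "\<lambda>_. 0"]] by linarith
  \<comment> \<open>The oscillation threshold before rescaling:
    \<open>c * (2 * a) = d\<close>.\<close>
  define a where "a = d / 2 / c"
  have a: "0 < a" using c d by (simp add: a_def)
  let ?X = "\<lambda>\<omega>. walk_hull n (\<lambda>i. c *\<^sub>R W i \<omega>)"
  let ?Y = "\<lambda>\<omega>. walk_hull m (\<lambda>j. c *\<^sub>R (\<Sum>i<q. W (j * q + i) \<omega>))"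
  define E where "E = {\<omega>\<in>space M. \<exists>j\<in>{..m}. \<exists>l\<in>{..q}. 2 * a < norm (\<Sum>i<l. W (j * q + i) \<omega>)}"
  have [measurable]: "E \<in> events" unfolding E_def by measurable
  \<comment> \<open>Since \<open>c\<^sup>2 = 1 / n\<close>, the Chebyshev bound for a block depends
    on \<open>n\<close> only through \<open>q / n\<close>, which is at most
    \<open>1 / m\<close>.\<close>
  have "real q * tvar / a\<^sup>2 = 4 * tvar / d\<^sup>2 * (real q / real n)"
    unfolding a_def by (simp add: power_divide c2)
  also have "\<dots> \<le> 4 * tvar / d\<^sup>2 * (1 / real m)"
  proof (rule mult_left_mono)
    have "real m * real q \<le> real n" using n1(1) by (metis of_nat_le_iff of_nat_mult)
    then show "real q / real n \<le> 1 / real m"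
      using m \<open>0 < n\<close> by (simp add: field_simps)
  qed (use tvar_nonneg in auto)
  also have "\<dots> \<le> 1 / 2" using var by simp
  finally have "real q * tvar / a\<^sup>2 \<le> 1 / 2" .
  from prob_block_oscillation[OF a this, of m]
  have PE: "prob E \<le> real (m + 1) * (2 * prob {\<omega>\<in>space M. a < norm (\<Sum>i<q. W i \<omega>)})"
    by (simp add: E_def)
  have "a < norm x \<longleftrightarrow> d / 2 < norm (c *\<^sub>R x)" for x :: "real^2"
    using c by (simp add: a_def pos_divide_less_eq mult_ac)
  then have PE: "prob E \<le> real (m + 1) * (2 * prob {\<omega>\<in>space M. d / 2 < norm (c *\<^sub>R (\<Sum>i<q. W i \<omega>))})"
    using PE by simp
  have mX: "(\<lambda>\<omega>. f (?X \<omega>)) \<in> borel_measurable M"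
    by (rule lip_coord_measurable[OF lip_coord_walk_hull[OF f C]]) simp
  have mY: "(\<lambda>\<omega>. f (?Y \<omega>)) \<in> borel_measurable M"
    by (rule lip_coord_measurable[OF lip_coord_walk_hull[OF f C]]) simp
  have i: "integrable M (\<lambda>\<omega>. f (?X \<omega>))" "integrable M (\<lambda>\<omega>. f (?Y \<omega>))"
    using mX mY lip_K20D(1)[OF f walk_hull_in_K20] by (auto intro!: integrable_const_bound[where B = B])
  have iE: "integrable M (indicat_real E)"
    by (rule integrable_const_bound[where B = 1]) (auto simp: indicator_def)
  have pointwise: "\<bar>f (?X \<omega>) - f (?Y \<omega>)\<bar> \<le> C * d + 2 * B * indicator E \<omega>" if "\<omega> \<in> space M" for \<omega>
  proof (cases "\<omega> \<in> E")
    case True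
    moreover have "0 \<le> C * d" using C d by simp
    moreover have "\<bar>f (?X \<omega>)\<bar> \<le> B" "\<bar>f (?Y \<omega>)\<bar> \<le> B"
      by (rule lip_K20D(1)[OF f walk_hull_in_K20])+
    ultimately show ?thesis by simp
  next
    case False
    have "hausdorff_dist (?X \<omega>) (walk_hull m (\<lambda>j. \<Sum>k<q. c *\<^sub>R W (j * q + k) \<omega>)) \<le> d"
    proof (rule hausdorff_walk_hull_blocks[OF _ n1])
      show "0 < q" using m mq by simp
      fix j l assume "j \<le> m" "l \<le> q"
      then have "norm (\<Sum>k<l. W (j * q + k) \<omega>) \<le> 2 * a"
        using False that by (force simp: E_def)
      then have "c * norm (\<Sum>k<l. W (j * q + k) \<omega>) \<le> c * (2 * a)"
        using c by (intro mult_left_mono) auto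
      then show "norm (\<Sum>k<l. c *\<^sub>R W (j * q + k) \<omega>) \<le> d"
        using c by (simp add: scaleR_sum_right[symmetric] a_def)
    qed
    then have "C * hausdorff_dist (?X \<omega>) (?Y \<omega>) \<le> C * d"
      using C by (intro mult_left_mono) (auto simp: scaleR_sum_right)
    then have "\<bar>f (?X \<omega>) - f (?Y \<omega>)\<bar> \<le> C * d"
      using lip_K20D(2)[OF f walk_hull_in_K20 walk_hull_in_K20] by (rule order_trans[rotated])
    then show ?thesis using False by simp
  qed
  have "\<bar>expectation (\<lambda>\<omega>. f (?X \<omega>)) - expectation (\<lambda>\<omega>. f (?Y \<omega>))\<bar>
      \<le> expectation (\<lambda>\<omega>. \<bar>f (?X \<omega>) - f (?Y \<omega>)\<bar>)"
    using i integral_norm_bound[of M "\<lambda>\<omega>. f (?X \<omega>) - f (?Y \<omega>)"] by simp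
  also have "\<dots> \<le> expectation (\<lambda>\<omega>. C * d + 2 * B * indicator E \<omega>)"
    using i iE by (intro integral_mono pointwise) auto
  also have "\<dots> = C * d + 2 * B * prob E"
    using iE by (subst Bochner_Integration.integral_add) (simp_all add: prob_space)
  also have "\<dots> \<le> C * d + 2 * B * (real (m + 1) * (2 * prob {\<omega>\<in>space M. d / 2 < norm (c *\<^sub>R (\<Sum>i<q. W i \<omega>))}))"
    using B PE by (intro add_left_mono mult_left_mono) auto
  finally show ?thesis unfolding q_def .
qed

text \<open>The parameters are chosen in the order \<open>d\<close>, \<open>m\<close>,
  \<open>n\<close>. The hypothesis \<open>sq\<close> matches the variance of the steps in each
  direction with that of the transformed Brownian motion.\<close>

lemma lip_walk_hull_tendsto:
  assumes "centered_iid M W" "planar_BM N b"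
    and sym: "transpose A = A" and sq: "\<And>t. (norm (A *v t))\<^sup>2 = centered_iid.qvar M W t"
    and f0: "lip_K20 B C0 f"
  shows "(\<lambda>n. \<integral>\<omega>. f (walk_hull n (\<lambda>i. (1 / sqrt (real n)) *\<^sub>R W i \<omega>)) \<partial>M)
    \<longlonglongrightarrow> (\<integral>\<omega>. f (planar_BM.path_hull b A \<omega>) \<partial>N)"
proof -
  interpret W: centered_iid M W by fact
  interpret BM: planar_BM N b A by fact
  define C where "C = \<bar>C0\<bar>"
  have f: "lip_K20 B C f" and C: "0 \<le> C"
    using lip_K20_abs[OF f0] by (auto simp: C_def)
  have B: "0 \<le> B" using lip_K20D(1)[OF f walk_hull_in_K20[of 0 "\<lambda>_. 0"]] by linarith
  obtain K where K: "0 < K" "\<And>x. norm (A *v x) \<le> K * norm x"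
    using bounded_linear.pos_bounded[OF matrix_vector_mul_bounded_linear[of A]] by (auto simp: mult.commute)
  define \<mu> where "\<mu> m n = distr M borel (\<lambda>\<omega>. (1 / sqrt (real n)) *\<^sub>R (\<Sum>i<n div m. W i \<omega>))" for m n
  have \<mu>: "prob_space (\<mu> m n)" "sets (\<mu> m n) = sets borel" for m n
    unfolding \<mu>_def by (auto intro!: W.prob_space_distr)
  have lim: "(\<lambda>n. char_vec (\<mu> m n) t) \<longlonglongrightarrow> char_vec (BM.step_law m) t" if m: "0 < m" for m t
  proof -
    have s: "0 < 1 / sqrt (real m)" using m by simp
    have "(1 / sqrt (real m) * norm (A *v t))\<^sup>2 / 2 = W.qvar t / (2 * real m)"
      using m by (simp add: power_mult_distrib power_divide sq)
    then have "char_vec (BM.step_law m) t = of_real (exp (- W.qvar t / (2 * real m)))"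
      unfolding BM.step_law_def char_vec_linear_gauss2[OF s] sym by simp
    then show ?thesis
      using W.char_block_sum_tendsto[OF m, of t] by (simp only: \<mu>_def)
  qed
  show ?thesis
  proof (rule LIMSEQ_I)
    fix e :: real assume e: "0 < e"
    define d where "d = e / (8 * (C + 1))"
    have d: "0 < d" and Cd: "C * d \<le> e / 8"
      using e C by (auto simp: d_def field_simps)
    \<comment> \<open>The factor 4 combines \<open>2 * B\<close> with the factor 2 from Ottaviani's
      inequality; \<open>d / 4\<close> is half of the threshold \<open>d / 2\<close>, and
      \<open>K\<close> bounds the operator norm of \<open>A\<close>. The Gaussian part of the error
      is then at most \<open>Q * (m + 1) / m^2\<close>.\<close>
    define Q where "Q = 4 * B * (12 / (d / 4 / K) ^ 4)"
    have inv: "(\<lambda>m. 1 / real m) \<longlonglongrightarrow> 0" by (rule lim_1_over_n)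
    have "(\<lambda>m. 4 * W.tvar / d\<^sup>2 * (1 / real m)) \<longlonglongrightarrow> 4 * W.tvar / d\<^sup>2 * 0"
      by (intro tendsto_mult_left inv)
    then have e1: "\<forall>\<^sub>F m in sequentially. 4 * W.tvar / d\<^sup>2 * (1 / real m) < 1 / 2"
      by (rule order_tendstoD) simp
    have "(\<lambda>m. Q * (1 / real m + 1 / real m * (1 / real m))) \<longlonglongrightarrow> Q * (0 + 0 * 0)"
      by (intro tendsto_mult_left tendsto_add tendsto_mult inv)
    then have e2: "\<forall>\<^sub>F m in sequentially. Q * (1 / real m + 1 / real m * (1 / real m)) < e / 8"
      by (rule order_tendstoD) (use e in simp)
    have e3: "\<forall>\<^sub>F m in sequentially. dist (\<integral>x. f (walk_hull m x) \<partial>PiM {..<m} (\<lambda>_. BM.step_law m))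
        (\<integral>\<omega>. f (BM.path_hull \<omega>) \<partial>N) < e / 8"
      by (rule tendstoD[OF BM.expectation_lip_path_hull_tendsto[OF f]]) (use e in simp)
    from eventually_conj[OF e1 eventually_conj[OF e2 eventually_conj[OF e3 eventually_gt_at_top[of 0]]]]
    obtain m where m1: "4 * W.tvar / d\<^sup>2 * (1 / real m) < 1 / 2"
      and m2: "Q * (1 / real m + 1 / real m * (1 / real m)) < e / 8"
      and m3: "dist (\<integral>x. f (walk_hull m x) \<partial>PiM {..<m} (\<lambda>_. BM.step_law m))
        (\<integral>\<omega>. f (BM.path_hull \<omega>) \<partial>N) < e / 8"
      and m: "0 < m"
      unfolding eventually_sequentially by blast
    note p' = BM.prob_space_step_law[OF m] BM.sets_step_law
    \<comment> \<open>Adding 1 makes the divisor positive also when \<open>B = 0\<close>.\<close>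
    define D where "D = 4 * B * real (m + 1) + 1"
    define \<eta> where "\<eta> = e / 8 / D"
    have pos: "0 < D" unfolding D_def using B by (intro add_nonneg_pos mult_nonneg_nonneg) auto
    have \<eta>: "0 < \<eta>" and \<eta>e: "4 * B * real (m + 1) * \<eta> \<le> e / 8"
    proof -
      show "0 < \<eta>" unfolding \<eta>_def using e pos by (intro divide_pos_pos) auto
      then have "4 * B * real (m + 1) * \<eta> \<le> D * \<eta>" unfolding D_def by (intro mult_right_mono) auto
      also have "\<dots> = e / 8" using pos by (simp add: \<eta>_def)
      finally show "4 * B * real (m + 1) * \<eta> \<le> e / 8" .
    qed
    have tail: "4 * B * real (m + 1) * measure (BM.step_law m) {x. d / 4 \<le> norm x} \<le> e / 8"
    proof -
      have "measure (BM.step_law m) {x. d / 4 \<le> norm x} \<le> 12 * (1 / sqrt (real m)) ^ 4 / (d / 4 / K) ^ 4"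
        unfolding BM.step_law_def by (rule linear_gauss2_tail[OF _ _ K]) (use m d in auto)
      also have "(1 / sqrt (real m)) ^ 4 = 1 / real m * (1 / real m)"
      proof -
        have "(1 / sqrt (real m)) ^ 4 = ((1 / sqrt (real m))\<^sup>2)\<^sup>2" by (simp add: power_mult[symmetric])
        then show ?thesis by (simp add: power_divide power2_eq_square)
      qed
      finally have "4 * B * real (m + 1) * measure (BM.step_law m) {x. d / 4 \<le> norm x}
          \<le> 4 * B * real (m + 1) * (12 * (1 / real m * (1 / real m)) / (d / 4 / K) ^ 4)"
        using B by (intro mult_left_mono mult_nonneg_nonneg) auto
      also have "\<dots> = Q * (real (m + 1) * (1 / real m * (1 / real m)))" by (simp add: Q_def mult_ac)
      also have "real (m + 1) * (1 / real m * (1 / real m)) = 1 / real m + 1 / real m * (1 / real m)"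
        using m by (simp add: field_simps)
      finally show ?thesis using m2 by linarith
    qed
    have d2: "0 < d / 2" and e8: "0 < e / 8" using d e by simp_all
    from eventually_tail_le[OF \<mu> p' lim[OF m] d2 \<eta>]
      uniform_lipschitz_convergence_PiM[OF \<mu> p' lim[OF m] B C e8, of m] eventually_ge_at_top[of "m * m"]
    have "\<forall>\<^sub>F n in sequentially. norm ((\<integral>\<omega>. f (walk_hull n (\<lambda>i. (1 / sqrt (real n)) *\<^sub>R W i \<omega>)) \<partial>M)
        - (\<integral>\<omega>. f (BM.path_hull \<omega>) \<partial>N)) < e"
    proof eventually_elim
      case (elim n)
      let ?c = "1 / sqrt (real n)"
      let ?p = "W.prob {\<omega>\<in>space M. d / 2 < norm (?c *\<^sub>R (\<Sum>i<n div m. W i \<omega>))}"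
      have "?p = measure (\<mu> m n) {x. d / 2 < norm x}"
        unfolding \<mu>_def by (subst measure_distr) (auto intro!: arg_cong[where f = W.prob])
      also have "\<dots> \<le> measure (BM.step_law m) {x. d / 4 \<le> norm x} + \<eta>"
        using elim(1) by simp
      finally have "4 * B * real (m + 1) * ?p \<le> 4 * B * real (m + 1) * (measure (BM.step_law m) {x. d / 4 \<le> norm x} + \<eta>)"
        using B by (intro mult_left_mono mult_nonneg_nonneg) auto
      then have p: "4 * B * real (m + 1) * ?p \<le> e / 4"
        using tail \<eta>e unfolding distrib_left by linarith
      have var: "4 * W.tvar / d\<^sup>2 / real m \<le> 1 / 2" using m1 by simp
      have "2 * B * (real (m + 1) * (2 * ?p)) = 4 * B * real (m + 1) * ?p" by simp
      with W.coarse_grained_hull_error[OF f C d m elim(3) var] p Cd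
      have 1: "\<bar>(\<integral>\<omega>. f (walk_hull n (\<lambda>i. ?c *\<^sub>R W i \<omega>)) \<partial>M)
          - (\<integral>\<omega>. f (walk_hull m (\<lambda>j. ?c *\<^sub>R (\<Sum>i<n div m. W (j * (n div m) + i) \<omega>))) \<partial>M)\<bar> \<le> 3 * e / 8"
        by linarith
      have 2: "(\<integral>\<omega>. f (walk_hull m (\<lambda>j. ?c *\<^sub>R (\<Sum>i<n div m. W (j * (n div m) + i) \<omega>))) \<partial>M)
          = (\<integral>x. f (walk_hull m x) \<partial>PiM {..<m} (\<lambda>_. \<mu> m n))"
        unfolding \<mu>_def by (rule W.integral_blocks[OF m lip_coord_walk_hull[OF f C]])
      have 3: "\<bar>(\<integral>x. f (walk_hull m x) \<partial>PiM {..<m} (\<lambda>_. \<mu> m n))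
          - (\<integral>x. f (walk_hull m x) \<partial>PiM {..<m} (\<lambda>_. BM.step_law m))\<bar> \<le> e / 8"
        by (rule elim(2)[rule_format, OF lip_coord_walk_hull[OF f C]])
      \<comment> \<open>The three errors are at most \<open>3 * e / 8\<close> for coarse-graining,
        \<open>e / 8\<close> for the exchange of laws and \<open>e / 8\<close> for discretising the
        Brownian path.\<close>
      show ?case
        using 1 3 m3 e unfolding 2 real_norm_def dist_real_def by linarith
    qed
    then show "\<exists>n0. \<forall>n\<ge>n0. norm ((\<integral>\<omega>. f (walk_hull n (\<lambda>i. (1 / sqrt (real n)) *\<^sub>R W i \<omega>)) \<partial>M)
        - (\<integral>\<omega>. f (BM.path_hull \<omega>) \<partial>N)) < e"
      by (simp only: eventually_sequentially)
  qed
qed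

lemma transpose_cov_matrix: "transpose (cov_matrix M X) = cov_matrix M X"
  by (simp add: transpose_eq_iff2 cov_matrix_def mult.commute)

text \<open>With zero mean the covariances are the plain mixed moments, and the square expands. This
  yields positive semidefiniteness of the covariance matrix and links its root to
  \<open>qvar\<close>.\<close>

lemma (in centered_iid) qvar_eq_quadratic_form: "t \<bullet> (cov_matrix M (W 0) *v t) = qvar t"
proof -
  have mean: "mean_vec M (W 0) = 0" using mean_zero by (simp add: mean_vec_def)
  have prod: "integrable M (\<lambda>\<omega>. W 0 \<omega> $ i * W 0 \<omega> $ j)" for i j
  proof (rule Bochner_Integration.integrable_bound[OF square_integrable])
    have "\<bar>W 0 \<omega> $ i * W 0 \<omega> $ j\<bar> \<le> (norm (W 0 \<omega>))\<^sup>2" for \<omega>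
      unfolding abs_mult power2_eq_square by (intro mult_mono component_le_norm_cart) auto
    then show "AE \<omega> in M. norm (W 0 \<omega> $ i * W 0 \<omega> $ j) \<le> norm ((norm (W 0 \<omega>))\<^sup>2)" by simp
  qed measurable
  have cov: "cov_matrix M (W 0) $ i $ j = expectation (\<lambda>\<omega>. W 0 \<omega> $ i * W 0 \<omega> $ j)" for i j
    by (simp add: cov_matrix_def mean)
  have "qvar t = expectation (\<lambda>\<omega>. (t $ 1)\<^sup>2 * (W 0 \<omega> $ 1 * W 0 \<omega> $ 1)
      + 2 * (t $ 1 * t $ 2) * (W 0 \<omega> $ 1 * W 0 \<omega> $ 2) + (t $ 2)\<^sup>2 * (W 0 \<omega> $ 2 * W 0 \<omega> $ 2))"
    unfolding qvar_def inner_vec2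
    by (intro Bochner_Integration.integral_cong refl) (simp add: power2_eq_square algebra_simps)
  also have "\<dots> = (t $ 1)\<^sup>2 * cov_matrix M (W 0) $ 1 $ 1 + 2 * (t $ 1 * t $ 2) * cov_matrix M (W 0) $ 1 $ 2
      + (t $ 2)\<^sup>2 * cov_matrix M (W 0) $ 2 $ 2"
    using prod by (simp add: cov)
  also have "\<dots> = t \<bullet> (cov_matrix M (W 0) *v t)"
    using transpose_cov_matrix[of M "W 0"] unfolding inner_mult_vec2 transpose_eq_iff2
    by (simp only: mult_ac mult_2 distrib_left distrib_right)
  finally show ?thesis ..
qed

theorem theorem2p5:
  fixes M :: "'a measure" and Z :: "nat \<Rightarrow> 'a \<Rightarrow> real^2"
    and N :: "'b measure" and b :: "'b \<Rightarrow> real \<Rightarrow> real^2"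
  assumes "prob_space M"
    and "\<And>k. Z k \<in> borel_measurable M"
    and "prob_space.indep_vars M (\<lambda>_. borel) Z UNIV"
    and "\<And>k. distr M borel (Z k) = distr M borel (Z 0)"
    and "integrable M (\<lambda>\<omega>. (norm (Z 0 \<omega>))\<^sup>2)"
    and "mean_vec M (Z 0) = 0"
    and "std_BM2 N b"
  shows "weak_conv_K20 M
           (\<lambda>n \<omega>. (\<lambda>x. (1 / sqrt (real n)) *\<^sub>R x) ` (
                    convex hull {(\<Sum>k\<in>{1..m}. Z k \<omega>) | m. m \<le> n}))
           N (\<lambda>\<omega>. (\<lambda>x. psd_sqrt (cov_matrix M (Z 0)) *v x) ` (convex hull (b \<omega> ` {0..1})))"
proof -
  define A where "A = psd_sqrt (cov_matrix M (Z 0))"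
  \<comment> \<open>The sums in the theorem begin with \<open>Z 1\<close>, whereas
    \<open>walk_hull\<close> begins with step 0.\<close>
  define W where "W i = Z (Suc i)" for i
  interpret prob_space M by fact
  interpret Z: centered_iid M Z
    by unfold_locales (use assms in \<open>auto simp: mean_vec_def\<close>)
  have W: "centered_iid M W"
    using Z.centered_iid_shift[of 1] by (simp add: W_def[abs_def])
  then interpret W: centered_iid M W .
  have BM: "planar_BM N b"
    using assms(7) by (simp add: planar_BM_def planar_BM_axioms_def std_BM2_def)
  interpret BM: planar_BM N b A by (rule BM)
  have quad: "0 \<le> x \<bullet> (cov_matrix M (Z 0) *v x)" for x
    unfolding Z.qvar_eq_quadratic_form by (rule Z.qvar_nonneg)
  note A = psd_sqrt2[OF transpose_cov_matrix quad, folded A_def]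
  \<comment> \<open>As \<open>A\<close> is symmetric with square the covariance matrix, the squared
    norm of \<open>A *v t\<close> is the covariance form at \<open>t\<close>; the shift does not
    change the law of the steps.\<close>
  have sq: "(norm (A *v t))\<^sup>2 = W.qvar t" for t
  proof -
    have "(norm (A *v t))\<^sup>2 = (transpose A *v t) \<bullet> (A *v t)"
      unfolding A(1) by (rule power2_norm_eq_inner)
    also have "\<dots> = t \<bullet> ((A ** A) *v t)"
      unfolding transpose_matrix_vector dot_lmul_matrix matrix_vector_mul_assoc ..
    also have "\<dots> = Z.qvar t"
      unfolding A(2) by (rule Z.qvar_eq_quadratic_form)
    also have "\<dots> = W.qvar t"
      unfolding Z.qvar_def W.qvar_def W_def by (rule Z.integral_W[symmetric]) simp
    finally show ?thesis .
  qed
  \<comment> \<open>Scaling commutes with the convex hull, so the factor can be moved onto the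
    single steps.\<close>
  have X_eq: "(\<lambda>x. (1 / sqrt (real n)) *\<^sub>R x) ` (convex hull {(\<Sum>k\<in>{1..m}. Z k \<omega>) | m. m \<le> n})
      = walk_hull n (\<lambda>i. (1 / sqrt (real n)) *\<^sub>R W i \<omega>)" for n \<omega>
  proof -
    have "{(\<Sum>k\<in>{1..m}. Z k \<omega>) | m. m \<le> n} = (\<lambda>j. \<Sum>i<j. W i \<omega>) ` {..n}"
      by (auto simp: W_def sum.atLeast1_atMost_eq)
    then show ?thesis
      unfolding walk_hull_def scaleR_sum_right[symmetric]
      by (simp only: convex_hull_scaling[symmetric] image_image)
  qed
  have Y_eq: "(\<lambda>x. A *v x) ` (convex hull (b \<omega> ` {0..1})) = BM.path_hull \<omega>" for \<omega>
    unfolding BM.path_hull_def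
    by (simp only: convex_hull_linear_image[OF matrix_vector_mul_linear] image_image)
  show ?thesis
    unfolding A_def[symmetric] X_eq Y_eq
  proof (rule weak_conv_K20_if_lip)
    show "prob_space M" "prob_space N" by (rule prob_space_axioms BM.prob_space_axioms)+
  next
    fix B C n and f :: "(real^2) set \<Rightarrow> real" assume f: "lip_K20 B C f"
    show "(\<lambda>\<omega>. f (walk_hull n (\<lambda>i. (1 / sqrt (real n)) *\<^sub>R W i \<omega>))) \<in> borel_measurable M"
      by (rule lip_coord_measurable[OF lip_coord_walk_hull[OF lip_K20_abs[OF f]]]) simp_all
  qed (assumption | rule walk_hull_in_K20 BM.path_hull_in_K20 BM.measurable_lip_path_hull 
      lip_walk_hull_tendsto[OF W BM A(1) sq])+
qed

end
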